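(* Let $n$ and $k$ be integers with $2\le k\le n-4$, and let $Q_k=Q(C_{n,k})$ be the matrix associated with the binary tree $C_{n,k}$ with $n$ boundary vertices defined in the context. Then $$\det Q_k=\frac{4^{n-2}(k+1)(n-k-1)}{2(n-1)^{2n}\,\bigl((n-2)!\bigr)^2\,(n-2)} .$$ Consequently, for any integers $k_1,k_2$ with $2\le k_1,k_2\le n-4$, $$\frac{\det Q_{k_1}}{\det Q_{k_2}}=\frac{(k_1+1)(n-k_1-1)}{(k_2+1)(n-k_2-1)},$$ and for fixed $k_1$ and $k_2$ this ratio has a finite limit as $n\to\infty$.
   Context: A binary tree is a finite tree in which every vertex has degree $1$ or $3$; its boundary vertices are its vertices of degree $1$. A binary tree with $n$ boundary vertices has $m=2n-3$ edges. For a binary tree $G$ with edges enumerated by $1,\dots,m$, let $q_i$ be the number of unordered pairs of distinct boundary vertices whose connecting path contains edge $i$. The $m\times m$ matrix $Q(G)=(Q_{ij})$ is defined by: $Q_{ij}$ is the number of unordered pairs of distinct boundary vertices whose connecting path contains both edges $i$ and $j$, divided by $q_iq_j$. Its determinant does not depend on the enumeration. The tree $C_{n,k}$, for $2\le k\le n-4$: take a path with consecutive vertices $v_0,v_1,\dots,v_{n-2}$ (so its edges are $e_t=v_{t-1}v_t$, $t=1,\dots,n-2$). For each $t\in\{1,\dots,n-3\}$ with $t\ne k$ attach to $v_t$ one new edge ending in a new vertex of degree $1$; to $v_k$ (the vertex between the $k$-th and $(k+1)$-th edges of the path) attach one new edge $v_ku$ and attach to $u$ two further new edges, each ending in a new vertex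 of degree $1$. The resulting tree is binary with $n$ boundary vertices. *)

theory Defs
  imports Complex_Main "Jordan_Normal_Form.Determinant"
begin

text \<open>Finite simple undirected graphs; an edge is the two-element set of its end points.\<close>

record 'a graph =
  verts :: "'a set"
  edges :: "'a set set"

definition simple_graph :: "'a graph \<Rightarrow> bool" where
  "simple_graph G \<longleftrightarrow> finite (verts G) \<and>
     edges G \<subseteq> {{x, y} | x y. x \<in> verts G \<and> y \<in> verts G \<and> x \<noteq> y}"

definition vertex_degree :: "'a graph \<Rightarrow> 'a \<Rightarrow> nat" where
  "vertex_degree G v = card {e \<in> edges G. v \<in> e}"

definition path_edges :: "'a list \<Rightarrow> 'a set set" where
  "path_edges p = {{p ! i, p ! Suc i} | i. Suc i < length p}"

text \<open>Paths visit no vertex twice.\<close>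

definition is_path :: "'a graph \<Rightarrow> 'a list \<Rightarrow> bool" where
  "is_path G p \<longleftrightarrow> p \<noteq> [] \<and> distinct p \<and> set p \<subseteq> verts G \<and> path_edges p \<subseteq> edges G"

definition path_between :: "'a graph \<Rightarrow> 'a \<Rightarrow> 'a \<Rightarrow> 'a list \<Rightarrow> bool" where
  "path_between G x y p \<longleftrightarrow> is_path G p \<and> hd p = x \<and> last p = y"

definition is_cycle :: "'a graph \<Rightarrow> 'a list \<Rightarrow> bool" where
  "is_cycle G p \<longleftrightarrow> is_path G p \<and> 3 \<le> length p \<and> {last p, hd p} \<in> edges G"

definition tree :: "'a graph \<Rightarrow> bool" where
  "tree G \<longleftrightarrow> simple_graph G \<and> verts G \<noteq> {} \<and>
     (\<forall>x\<in>verts G. \<forall>y\<in>verts G. (x, y) \<in> {(a, b). {a, b} \<in> edges G}\<^sup>*) \<and>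
     (\<nexists>p. is_cycle G p)"

definition binary_tree :: "'a graph \<Rightarrow> bool" where
  "binary_tree G \<longleftrightarrow> tree G \<and> (\<forall>v\<in>verts G. vertex_degree G v \<in> {1, 3})"

definition boundary :: "'a graph \<Rightarrow> 'a set" where
  "boundary G = {v \<in> verts G. vertex_degree G v = 1}"

text \<open>
  The number of unordered pairs of distinct boundary vertices whose connecting path contains all
  edges in \<open>F\<close>. In a tree the connecting path is unique, so the existential
  quantifier over \<open>p\<close> speaks about that path.
\<close>

definition pair_count :: "'a graph \<Rightarrow> 'a set set \<Rightarrow> nat" where
  "pair_count G F = card {{x, y} | x y. x \<in> boundary G \<and> y \<in> boundary G \<and> x \<noteq> y \<and>
     (\<exists>p. path_between G x y p \<and> F \<subseteq> path_edges p)}"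

definition edge_enumeration :: "'a graph \<Rightarrow> 'a set list \<Rightarrow> bool" where
  "edge_enumeration G es \<longleftrightarrow> distinct es \<and> set es = edges G"

text \<open>The matrix \<open>Q(G)\<close> with respect to the enumeration \<open>es\<close> of the edges.\<close>

definition Q :: "'a graph \<Rightarrow> 'a set list \<Rightarrow> real mat" where
  "Q G es = mat (length es) (length es) (\<lambda>(i, j).
     real (pair_count G {es ! i, es ! j}) /
     (real (pair_count G {es ! i}) * real (pair_count G {es ! j})))"

text \<open>
  In the tree \<open>C n k\<close>, the vertex \<open>V t\<close> is \<open>v\<^sub>t\<close>, the vertex \<open>L t\<close> is the end of the edge attached
  to \<open>v\<^sub>t\<close>, and \<open>W\<^sub>1\<close>, \<open>W\<^sub>2\<close> (here \<open>W1\<close>, \<open>W2\<close>) are the two further ends attached to \<open>u\<close> (here \<open>U\<close>).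
\<close>

datatype vertex = V nat | L nat | U | W1 | W2

definition C :: "nat \<Rightarrow> nat \<Rightarrow> vertex graph" where
  "C n k = \<lparr>
     verts = V ` {0..n - 2} \<union> L ` ({1..n - 3} - {k}) \<union> {U, W1, W2},
     edges = {{V (t - 1), V t} | t. t \<in> {1..n - 2}}
           \<union> {{V t, L t} | t. t \<in> {1..n - 3} \<and> t \<noteq> k}
           \<union> {{V k, U}, {U, W1}, {U, W2}} \<rparr>"

lemma C_verts:
  "V t \<in> verts (C n k) \<longleftrightarrow> t \<le> n - 2"
  "L t \<in> verts (C n k) \<longleftrightarrow> t \<in> {1..n - 3} \<and> t \<noteq> k"
  "U \<in> verts (C n k)" "W1 \<in> verts (C n k)" "W2 \<in> verts (C n k)"
  by (auto simp: C_def)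

lemma C_spine_edge:
  assumes "t < n - 2"
  shows "{V t, V (Suc t)} \<in> edges (C n k)"
proof -
  have "\<exists>s. {V t, V (Suc t)} = {V (s - 1), V s} \<and> s \<in> {1..n - 2}"
    using assms by (intro exI[of _ "Suc t"]) simp
  then show ?thesis unfolding C_def by simp
qed

lemma C_edge_cases:
  assumes "e \<in> edges (C n k)"
  obtains t where "t < n - 2" "e = {V t, V (Suc t)}"
  | t where "t \<in> {1..n - 3}" "t \<noteq> k" "e = {V t, L t}"
  | "e = {V k, U}" | "e = {U, W1}" | "e = {U, W2}"
proof -
  consider t where "t \<in> {1..n - 2}" "e = {V (t - 1), V t}"
    | t where "t \<in> {1..n - 3}" "t \<noteq> k" "e = {V t, L t}"
    | "e = {V k, U}" | "e = {U, W1}" | "e = {U, W2}"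
    using assms unfolding C_def by auto
  then show ?thesis
  proof cases
    case (1 t)
    then show ?thesis using that(1)[of "t - 1"] by auto
  next
    case (2 t)
    then show ?thesis using that(2) by blast
  qed (use that(3-5) in blast)+
qed

lemma C_simple:
  assumes "2 \<le> k" "k \<le> n - 4"
  shows "simple_graph (C n k)"
proof -
  let ?S = "{{x, y} | x y. x \<in> verts (C n k) \<and> y \<in> verts (C n k) \<and> x \<noteq> y}"
  have S: "{x, y} \<in> ?S" if "x \<in> verts (C n k)" "y \<in> verts (C n k)" "x \<noteq> y" for x y
    using that by blast
  have "e \<in> ?S" if "e \<in> edges (C n k)" for e
    using that
  proof (cases rule: C_edge_cases)
    case (1 t)
    then show ?thesis using S[of "V t" "V (Suc t)"] by (simp only: C_verts) simp
  next
    case (2 t)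
    then have "t \<le> n - 3" by simp
    then have "t \<le> n - 2" by linarith
    then show ?thesis using 2 S[of "V t" "L t"] by (simp only: C_verts) simp
  next
    case 3
    have "k \<le> n - 2" using assms by simp
    then show ?thesis using 3 S[of "V k" U] by (simp only: C_verts) simp
  next
    case 4
    then show ?thesis using S[of U W1] by (simp only: C_verts) simp
  next
    case 5
    then show ?thesis using S[of U W2] by (simp only: C_verts) simp
  qed
  then have "edges (C n k) \<subseteq> ?S" by blast
  moreover have "finite (verts (C n k))" by (simp add: C_def)
  ultimately show ?thesis unfolding simple_graph_def by blast
qed

lemma C_connected:
  assumes "2 \<le> k" "k \<le> n - 4" and "x \<in> verts (C n k)" "y \<in> verts (C n k)"
  shows "(x, y) \<in> {(a, b). {a, b} \<in> edges (C n k)}\<^sup>*"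
proof -
  let ?R = "{(a, b). {a, b} \<in> edges (C n k)}"
  have spine: "(V t, V 0) \<in> ?R\<^sup>*" if "t \<le> n - 2" for t
    using that
  proof (induction t)
    case (Suc t)
    have "{V t, V (Suc t)} \<in> edges (C n k)"
      using Suc.prems by (intro C_spine_edge) simp
    then have "(V (Suc t), V t) \<in> ?R" by (simp add: insert_commute)
    with Suc show ?case by (simp add: converse_rtrancl_into_rtrancl)
  qed simp
  have root: "(z, V 0) \<in> ?R\<^sup>*" if "z \<in> verts (C n k)" for z
  proof -
    have e: "{U, V k} \<in> edges (C n k)" "{W1, U} \<in> edges (C n k)" "{W2, U} \<in> edges (C n k)"
      by (auto simp: C_def)
    have l: "{L t, V t} \<in> edges (C n k)" if "t \<in> {1..n - 3}" "t \<noteq> k" for t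
    proof -
      have "{V t, L t} \<in> edges (C n k)" using that by (auto simp: C_def)
      then show ?thesis by (simp add: insert_commute)
    qed
    have u: "(U, V 0) \<in> ?R\<^sup>*"
      using spine[of k] e assms by (auto intro: converse_rtrancl_into_rtrancl)
    show ?thesis
    proof (cases z)
      case (V t)
      then show ?thesis using that spine by (simp add: C_verts)
    next
      case (L t)
      then have "t \<in> {1..n - 3}" "t \<noteq> k" using that by (simp_all add: C_verts)
      then show ?thesis using l[of t] spine[of t] L
        by (auto intro: converse_rtrancl_into_rtrancl)
    qed (use u e in \<open>auto intro: converse_rtrancl_into_rtrancl\<close>)
  qed
  have "sym ?R" by (auto intro!: symI simp: insert_commute)
  then have "(V 0, y) \<in> ?R\<^sup>*" using root[OF assms(4)] sym_rtrancl symD by metis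
  with root[OF assms(3)] show ?thesis by (rule rtrancl_trans)
qed

lemma C_acyclic:
  assumes "2 \<le> k" "k \<le> n - 4"
  shows "\<not> is_cycle (C n k) p"
proof
  assume cyc: "is_cycle (C n k) p"
  define r where "r v = (case v of V t \<Rightarrow> t | L t \<Rightarrow> n + t | U \<Rightarrow> n | W1 \<Rightarrow> n + 1 | W2 \<Rightarrow> n + 1)" for v
  define par where
    "par v = (case v of V t \<Rightarrow> V (t - 1) | L t \<Rightarrow> V t | U \<Rightarrow> V k | W1 \<Rightarrow> U | W2 \<Rightarrow> U)" for v
  have par: "y = par x" if "{x, y} \<in> edges (C n k)" "r y \<le> r x" for x y
    using that(1)
    by (cases rule: C_edge_cases)
      (use that(2) assms in \<open>auto simp: doubleton_eq_iff r_def par_def\<close>)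
  let ?l = "length p"
  have l3: "3 \<le> ?l" and d: "distinct p" and pe: "path_edges p \<subseteq> edges (C n k)"
    and ce: "{last p, hd p} \<in> edges (C n k)" and ne: "p \<noteq> []"
    using cyc by (auto simp: is_cycle_def is_path_def)
  have nxt: "{p ! i, p ! (if Suc i < ?l then Suc i else 0)} \<in> edges (C n k)" if "i < ?l" for i
  proof (cases "Suc i < ?l")
    case True
    then show ?thesis using pe by (auto simp: path_edges_def)
  next
    case False
    then have "i = ?l - 1" using that by simp
    then show ?thesis using ce ne l3 by (simp add: last_conv_nth hd_conv_nth)
  qed
  have prv: "{p ! i, p ! (if i = 0 then ?l - 1 else i - 1)} \<in> edges (C n k)" if "i < ?l" for i
  proof (cases "i = 0")
    case True
    have "{p ! (?l - 1), p ! 0} \<in> edges (C n k)" proof -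
      have "?l - 1 < ?l" "\<not> Suc (?l - 1) < ?l" using l3 by linarith+
      then show ?thesis using nxt[of "?l - 1"] by (simp only: if_False)
    qed
    then show ?thesis using True by (simp add: insert_commute)
  next
    case False
    then have "Suc (i - 1) < ?l" using that by simp
    then show ?thesis using nxt[of "i - 1"] False that by (simp add: insert_commute)
  qed
  obtain x where x: "x \<in> set p" "\<And>y. y \<in> set p \<Longrightarrow> r y \<le> r x"
  proof -
    have "Max (r ` set p) \<in> r ` set p" using ne by (intro Max_in) auto
    then obtain x where "x \<in> set p" "Max (r ` set p) = r x" by auto
    then show ?thesis using that by (metis Max_ge List.finite_set finite_imageI imageI)
  qed
  obtain i where i: "i < ?l" "x = p ! i" using x(1) by (metis in_set_conv_nth)
  let ?a = "if Suc i < ?l then Suc i else 0"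
  let ?b = "if i = 0 then ?l - 1 else i - 1"
  have ab: "?a < ?l" "?b < ?l" "?a \<noteq> ?b" using l3 i by auto
  have "p ! ?a = par x" "p ! ?b = par x"
    using par[OF nxt[OF i(1)]] par[OF prv[OF i(1)]] x(2) ab i by (metis nth_mem)+
  then have "p ! ?a = p ! ?b" by simp
  then show False using ab nth_eq_iff_index_eq[OF d ab(1) ab(2)] by simp
qed

lemma C_star:
  assumes "S \<subseteq> edges (C n k)" "\<And>e. e \<in> S \<Longrightarrow> v \<in> e"
    and "\<And>t. t < n - 2 \<Longrightarrow> v = V t \<or> v = V (Suc t) \<Longrightarrow> {V t, V (Suc t)} \<in> S"
    and "\<And>t. t \<in> {1..n - 3} \<Longrightarrow> t \<noteq> k \<Longrightarrow> v = V t \<or> v = L t \<Longrightarrow> {V t, L t} \<in> S"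
    and "v = V k \<or> v = U \<Longrightarrow> {V k, U} \<in> S"
    and "v = U \<or> v = W1 \<Longrightarrow> {U, W1} \<in> S"
    and "v = U \<or> v = W2 \<Longrightarrow> {U, W2} \<in> S"
  shows "vertex_degree (C n k) v = card S"
proof -
  have "e \<in> S" if e: "e \<in> edges (C n k)" "v \<in> e" for e
    using e(1)
  proof (cases rule: C_edge_cases)
    case (1 t)
    then show ?thesis using e(2) assms(3)[of t] by simp
  next
    case (2 t)
    then show ?thesis using e(2) assms(4)[of t] by simp
  qed (use e(2) assms(5-7) in simp_all)
  then have "{e \<in> edges (C n k). v \<in> e} = S" using assms(1,2) by blast
  then show ?thesis by (simp add: vertex_degree_def)
qed

lemma C_degree:
  assumes "2 \<le> k" "k \<le> n - 4" and "v \<in> verts (C n k)"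
  shows "vertex_degree (C n k) v = (if v \<in> {V 0, V (n - 2), W1, W2} \<union> range L then 1 else 3)"
proof -
  have n: "n \<ge> 6" using assms by simp
  consider "v = V 0" | "v = V (n - 2)"
    | t where "v = V t" "1 \<le> t" "t \<le> n - 3" "t \<noteq> k" | "v = V k"
    | t where "v = L t" "t \<in> {1..n - 3}" "t \<noteq> k" | "v = U" | "v = W1" | "v = W2"
  proof (cases v)
    case (V t)
    then have "t \<le> n - 2" using assms(3) by (simp add: C_verts)
    then have "t = 0 \<or> t = n - 2 \<or> t = k \<or> 1 \<le> t \<and> t \<le> n - 3 \<and> t \<noteq> k" by linarith
    then show ?thesis using V that(1,2,4) that(3)[of t] by auto
  next
    case (L t)
    then show ?thesis using assms(3) that(5)[of t] by (simp add: C_verts)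
  qed (use that(6-8) in simp_all)
  then show ?thesis
  proof cases
    case 1
    have "vertex_degree (C n k) (V 0) = card {{V 0, V (Suc 0)}}"
      by (rule C_star) (use C_spine_edge[of 0 n k] n assms in auto)
    then show ?thesis using 1 by simp
  next
    case 2
    obtain s where s: "n - 2 = Suc s" using n by (cases "n - 2") auto
    have "vertex_degree (C n k) (V (Suc s)) = card {{V s, V (Suc s)}}"
      by (rule C_star) (use C_spine_edge[of s n k] s n assms in auto)
    then show ?thesis using 2 s by simp
  next
    case (3 t)
    obtain s where s: "t = Suc s" using 3 by (cases t) auto
    have "{V s, V t} \<in> edges (C n k)" "{V t, V (Suc t)} \<in> edges (C n k)"
      using n 3 s C_spine_edge[of s n k] C_spine_edge[of t n k] by auto
    moreover have "{V t, L t} \<in> edges (C n k)" using 3 by (auto simp: C_def)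
    ultimately have "vertex_degree (C n k) (V t) = card {{V s, V t}, {V t, V (Suc t)}, {V t, L t}}"
      by (intro C_star) (use s 3 in auto)
    also have "\<dots> = 3" using s by (simp add: doubleton_eq_iff card_insert_if)
    finally show ?thesis using 3 n by auto
  next
    case 4
    obtain s where s: "k = Suc s" using assms by (cases k) auto
    have "{V s, V k} \<in> edges (C n k)" "{V k, V (Suc k)} \<in> edges (C n k)"
      using assms s C_spine_edge[of s n k] C_spine_edge[of k n k] by auto
    moreover have "{V k, U} \<in> edges (C n k)" by (simp add: C_def)
    ultimately have "vertex_degree (C n k) (V k) = card {{V s, V k}, {V k, V (Suc k)}, {V k, U}}"
      by (intro C_star) (use s in auto)
    also have "\<dots> = 3" using s by (simp add: doubleton_eq_iff card_insert_if)
    finally show ?thesis using 4 n assms by auto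
  next
    case (5 t)
    have "{V t, L t} \<in> edges (C n k)" using 5 by (auto simp: C_def)
    then have "vertex_degree (C n k) (L t) = card {{V t, L t}}"
      by (intro C_star) auto
    then show ?thesis using 5 by simp
  next
    case 6
    have "vertex_degree (C n k) U = card {{V k, U}, {U, W1}, {U, W2}}"
      by (rule C_star) (auto simp: C_def)
    also have "\<dots> = 3" by (simp add: doubleton_eq_iff card_insert_if)
    finally show ?thesis using 6 by auto
  next
    case 7
    have "vertex_degree (C n k) W1 = card {{U, W1}}"
      by (rule C_star) (auto simp: C_def)
    then show ?thesis using 7 by simp
  next
    case 8
    have "vertex_degree (C n k) W2 = card {{U, W2}}"
      by (rule C_star) (auto simp: C_def)
    then show ?thesis using 8 by simp
  qed
qed

lemma C_binary_tree:
  assumes "2 \<le> k" "k \<le> n - 4"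
  shows "binary_tree (C n k)"
proof -
  have "verts (C n k) \<noteq> {}" by (auto simp: C_def)
  then show ?thesis
    using C_simple[OF assms] C_connected[OF assms] C_acyclic[OF assms] C_degree[OF assms]
    by (auto simp: binary_tree_def tree_def)
qed

lemma C_card_boundary:
  assumes "2 \<le> k" "k \<le> n - 4"
  shows "card (boundary (C n k)) = n"
proof -
  have "boundary (C n k) = {V 0, V (n - 2), W1, W2} \<union> L ` ({1..n - 3} - {k})"
  proof (rule Set.set_eqI)
    fix v :: vertex
    have "v \<in> boundary (C n k) \<longleftrightarrow>
        v \<in> verts (C n k) \<and> v \<in> {V 0, V (n - 2), W1, W2} \<union> range L"
      by (cases "v \<in> verts (C n k)") (simp_all add: boundary_def C_degree[OF assms])
    then show "v \<in> boundary (C n k) \<longleftrightarrow>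
        v \<in> {V 0, V (n - 2), W1, W2} \<union> L ` ({1..n - 3} - {k})"
      by (cases v) (auto simp: C_verts)
  qed
  moreover have "card (L ` ({1..n - 3} - {k})) = n - 4"
    using assms by (subst card_image) (auto simp: inj_on_def)
  moreover have "card {V 0, V (n - 2), W1, W2} = 4"
    using assms by (auto simp: card_insert_if)
  moreover have "{V 0, V (n - 2), W1, W2} \<inter> L ` ({1..n - 3} - {k}) = {}"
    by auto
  moreover have "n \<ge> 4" using assms by simp
  ultimately show ?thesis
    using card_Un_disjoint[of "{V 0, V (n - 2), W1, W2}" "L ` ({1..n - 3} - {k})"]
    by simp
qed

end

theory Submission
  imports Defs
begin

text \<open>
  Let \<open>P\<close> be the matrix of the numbers of pairs of leaves whose path contains both edges \<open>i\<close> and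
  \<open>j\<close>. As \<open>Q\<close> arises from \<open>P\<close> by dividing row and column \<open>e\<close> by \<open>q e\<close>, its determinant is
  that of \<open>P\<close> divided by the square of the product of all \<open>q e\<close>. The reason for the formula is that
  for every binary tree with \<open>n\<close> leaves
  \<open>det P = 4 ^ (n - 2) * (\<Prod>e. q e)\<close>,
  the product being over the edges that do not end in a leaf (\<open>det_separation_matrix\<close>).

  To see this, root the tree at a leaf and write \<open>a e\<close> for the number of leaves below \<open>e\<close>. A path
  contains \<open>e\<close> exactly if \<open>e\<close> separates its ends (\<open>path_crosses_cut\<close>), so the entries of \<open>P\<close> are
  \<open>a i * (n - a j)\<close> if \<open>i\<close> equals or lies below \<open>j\<close>, and
  \<open>a i * a j\<close> if neither lies below the other.
  Gaussian elimination in post-order produces no fill-in: at a vertex with upper edge \<open>p\<close> and lower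
  edges \<open>l\<close> and \<open>r\<close>, the row of \<open>l\<close> is cleared by the rows of \<open>r\<close> and \<open>p\<close>, and then the row of
  \<open>r\<close> by the row of \<open>p\<close> (\<open>first_child_combination\<close>, \<open>second_child_combination\<close>). The pivots are
  \<open>4 * a l * a r * (n - a p) / n\<close> and \<open>n * a l * a r / a p\<close>, and their product telescopes.

  An edge at a leaf has \<open>q e = n - 1\<close>. In \<open>C n k\<close> the remaining edges are the edge from \<open>V k\<close> to \<open>U\<close>,
  with \<open>q e = 2 * (n - 2)\<close>, and the inner edges of the spine. The latter have \<open>q e = s * (n - s)\<close>,
  where \<open>s\<close> runs through \<open>2, \<dots>, n - 2\<close> without \<open>k + 1\<close>, because the two leaves at \<open>U\<close> join the
  spine together. The missing factor \<open>(k + 1) * (n - k - 1)\<close> is what distinguishes different \<open>k\<close>.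
\<close>

section \<open>Determinants of matrices indexed by an enumeration\<close>

text \<open>
  Matrices are handled through functions on edges rather than on positions, so that the order of
  the edges can be changed freely.
\<close>

definition enum_mat :: "'e list \<Rightarrow> ('e \<Rightarrow> 'e \<Rightarrow> 'a) \<Rightarrow> 'a mat" where
  "enum_mat es f = mat (length es) (length es) (\<lambda>(i, j). f (es ! i) (es ! j))"

lemma enum_mat_carrier [simp]: "enum_mat es f \<in> carrier_mat (length es) (length es)"
  by (simp add: enum_mat_def)

text \<open>
  Reordering the enumeration permutes rows and columns by the same permutation, whose sign then
  enters twice.
\<close>

lemma det_enum_mat_cong_mset:
  fixes f :: "'e \<Rightarrow> 'e \<Rightarrow> 'a :: comm_ring_1"
  assumes "mset xs = mset ys"
  shows "Determinant.det (enum_mat xs f) = Determinant.det (enum_mat ys f)"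
proof -
  obtain \<pi> where \<pi>: "\<pi> permutes {..<length ys}" "permute_list \<pi> ys = xs"
    using mset_eq_permutation[OF assms] by blast
  let ?n = "length ys"
  have len: "length xs = ?n" using \<pi>(2) by auto
  have nth: "xs ! i = ys ! \<pi> i" if "i < ?n" for i
    using \<pi> that permute_list_nth by metis
  have perm: "\<pi> permutes {0..<?n}" using \<pi>(1) by (simp add: atLeast0LessThan)
  have lt: "\<pi> i < ?n" if "i < ?n" for i using permutes_in_image[OF \<pi>(1)] that by simp
  define M where "M = enum_mat ys f"
  define M1 where "M1 = mat ?n ?n (\<lambda>(i, j). M $$ (\<pi> i, j))"
  have M: "M \<in> carrier_mat ?n ?n" by (simp add: M_def)
  have M1: "M1 \<in> carrier_mat ?n ?n" by (simp add: M1_def)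
  have d1: "Determinant.det M1 = signof \<pi> * Determinant.det M"
    unfolding M1_def by (rule det_permute_rows[OF M perm])
  have "Determinant.det (mat ?n ?n (\<lambda>(i, j). (transpose_mat M1) $$ (\<pi> i, j)))
      = signof \<pi> * Determinant.det (transpose_mat M1)"
    by (rule det_permute_rows[OF _ perm]) (use M1 in auto)
  also have "mat ?n ?n (\<lambda>(i, j). (transpose_mat M1) $$ (\<pi> i, j)) = transpose_mat (enum_mat xs f)"
    using lt by (intro eq_matI) (auto simp: M1_def M_def enum_mat_def len nth)
  finally have d2: "Determinant.det (enum_mat xs f) = signof \<pi> * Determinant.det M1"
    using M1 by (simp add: det_transpose[where n = ?n] len det_transpose[OF enum_mat_carrier])
  have "signof \<pi> * (signof \<pi> :: 'a) = 1" by (simp add: sign_def)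
  then show ?thesis unfolding d2 d1 M_def by (simp add: mult.assoc[symmetric])
qed

text \<open>
  The coefficients \<open>c\<close>, one family per row, form a unitriangular matrix \<open>R\<close> once the indices are
  sorted by \<open>rank\<close>, and the last condition makes \<open>R\<close> times the given matrix triangular on the other
  side, with the numbers \<open>d e\<close> on the diagonal. So it suffices to know one good combination of rows
  for each index, without ever writing down an ordered matrix.
\<close>

lemma det_by_row_combinations:
  fixes f :: "'e \<Rightarrow> 'e \<Rightarrow> 'a :: idom" and rank :: "'e \<Rightarrow> nat"
  assumes dist: "distinct es" and inj: "inj_on rank (set es)"
    and row: "\<And>e. e \<in> set es \<Longrightarrow> \<exists>c. c e = 1 \<and>
      (\<forall>i\<in>set es. rank i < rank e \<longrightarrow> c i = 0) \<and>
      (\<Sum>i\<in>set es. c i * f i e) = d e \<and>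
      (\<forall>j\<in>set es. rank e < rank j \<longrightarrow> (\<Sum>i\<in>set es. c i * f i j) = 0)"
  shows "Determinant.det (enum_mat es f) = (\<Prod>e\<in>set es. d e)"
proof -
  define good where "good e c \<longleftrightarrow> c e = 1 \<and>
      (\<forall>i\<in>set es. rank i < rank e \<longrightarrow> c i = 0) \<and>
      (\<Sum>i\<in>set es. c i * f i e) = d e \<and>
      (\<forall>j\<in>set es. rank e < rank j \<longrightarrow> (\<Sum>i\<in>set es. c i * f i j) = 0)" for e c
  define c where "c e = (SOME x. good e x)" for e
  have "good e (c e)" if "e \<in> set es" for e
  proof -
    have "\<exists>x. good e x" using row[OF that] unfolding good_def .
    then show ?thesis unfolding c_def by (rule someI_ex)
  qed
  then have c: "\<And>e. e \<in> set es \<Longrightarrow> c e e = 1"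
      "\<And>e i. e \<in> set es \<Longrightarrow> i \<in> set es \<Longrightarrow> rank i < rank e \<Longrightarrow> c e i = 0"
      "\<And>e. e \<in> set es \<Longrightarrow> (\<Sum>i\<in>set es. c e i * f i e) = d e"
      "\<And>e j. e \<in> set es \<Longrightarrow> j \<in> set es \<Longrightarrow> rank e < rank j \<Longrightarrow> (\<Sum>i\<in>set es. c e i * f i j) = 0"
    by (simp_all add: good_def)
  define xs where "xs = sort_key rank es"
  have xs: "mset xs = mset es" "set xs = set es" "distinct xs"
    using dist by (simp_all add: xs_def)
  let ?n = "length xs"
  have inS: "xs ! i \<in> set es" if "i < ?n" for i using that xs(2) nth_mem by blast
  have less: "rank (xs ! i) < rank (xs ! j)" if "i < j" "j < ?n" for i j
  proof -
    have "sorted (map rank xs)" by (simp add: xs_def)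
    then have "rank (xs ! i) \<le> rank (xs ! j)"
      using that sorted_nth_mono[of "map rank xs" i j] by simp
    moreover have "rank (xs ! i) \<noteq> rank (xs ! j)"
      using inj_onD[OF inj _ inS inS, of i j] that nth_eq_iff_index_eq[OF xs(3), of i j] by force
    ultimately show ?thesis by simp
  qed
  have sum: "(\<Sum>k<?n. g (xs ! k)) = (\<Sum>i\<in>set es. g i)" for g :: "'e \<Rightarrow> 'a"
    using sum.reindex_bij_betw[OF bij_betw_nth[OF xs(3) refl refl], of g] xs(2) by simp
  define R where "R = enum_mat xs c"
  define M where "M = enum_mat xs f"
  have RM: "(R * M) $$ (i, j) = (\<Sum>k\<in>set es. c (xs ! i) k * f k (xs ! j))"
    if "i < ?n" "j < ?n" for i j
    unfolding R_def M_def enum_mat_def using that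
    by (simp add: scalar_prod_def sum[symmetric] atLeast0LessThan)
  have "Determinant.det R = prod_list (diag_mat R)"
    by (rule det_upper_triangular[of _ ?n])
      (auto simp: R_def enum_mat_def upper_triangular_def simp: c inS less)
  also have "diag_mat R = map (\<lambda>i. 1) [0..<?n]"
    using c inS by (auto simp: diag_mat_def R_def enum_mat_def)
  finally have detR: "Determinant.det R = 1" by (simp add: map_replicate_const)
  have "Determinant.det (R * M) = prod_list (diag_mat (R * M))"
  proof (rule det_lower_triangular[of ?n])
    fix i j assume "i < j" "j < ?n"
    then show "(R * M) $$ (i, j) = 0" using RM[of i j] c inS[of i] inS[of j] less[of i j] by simp
  qed (unfold R_def M_def, rule mult_carrier_mat[OF enum_mat_carrier enum_mat_carrier])
  also have "diag_mat (R * M) = map (\<lambda>i. d (xs ! i)) [0..<?n]"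
    using RM c inS by (auto simp: diag_mat_def R_def M_def enum_mat_def)
  also have "\<dots> = map d xs" by (rule nth_equalityI) auto
  also have "prod_list (map d xs) = (\<Prod>e\<in>set es. d e)"
    using prod.distinct_set_conv_list[OF xs(3), of d] xs(2) by simp
  finally have "Determinant.det (R * M) = (\<Prod>e\<in>set es. d e)" .
  moreover have "Determinant.det (R * M) = Determinant.det R * Determinant.det M"
    by (rule det_mult[of _ ?n]) (simp_all add: R_def M_def)
  ultimately show ?thesis using detR det_enum_mat_cong_mset[OF xs(1), of f] by (simp add: M_def)
qed

lemma sum_delta_times:
  fixes c :: "'a :: semiring_1"
  assumes "finite E" "x \<in> E"
  shows "(\<Sum>i\<in>E. (if i = x then c else 0) * g i) = c * g x"
proof -
  have "(\<Sum>i\<in>E. (if i = x then c else 0) * g i) = (\<Sum>i\<in>E. if i = x then c * g i else 0)"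
    by (rule sum.cong) auto
  then show ?thesis using assms by simp
qed

lemma det_enum_mat_scaled:
  fixes f :: "'e \<Rightarrow> 'e \<Rightarrow> 'a :: field"
  assumes "distinct es"
  shows "Determinant.det (enum_mat es (\<lambda>i j. f i j / (q i * q j))) =
    Determinant.det (enum_mat es f) / (\<Prod>e\<in>set es. q e)\<^sup>2"
proof -
  let ?n = "length es"
  define D where "D = mat ?n ?n (\<lambda>(i, j). if i = j then 1 / q (es ! i) else 0)"
  have D: "D \<in> carrier_mat ?n ?n" by (simp add: D_def)
  let ?M = "enum_mat es f"
  have DM: "(D * ?M) $$ (i, j) = f (es ! i) (es ! j) / q (es ! i)" if "i < ?n" "j < ?n" for i j
  proof -
    have "(D * ?M) $$ (i, j) = (\<Sum>k\<in>{0..<?n}. (if k = i then 1 / q (es ! i) else 0) * f (es ! k) (es ! j))"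
      using that by (auto simp: D_def enum_mat_def scalar_prod_def intro!: sum.cong)
    also have "\<dots> = 1 / q (es ! i) * f (es ! i) (es ! j)"
      by (rule sum_delta_times) (use that in auto)
    finally show ?thesis by simp
  qed
  have car: "D * ?M \<in> carrier_mat ?n ?n" by (rule mult_carrier_mat[OF D enum_mat_carrier])
  have "D * ?M * D = enum_mat es (\<lambda>i j. f i j / (q i * q j))"
  proof (rule eq_matI)
    fix i j assume "i < dim_row (enum_mat es (\<lambda>i j. f i j / (q i * q j)))"
      "j < dim_col (enum_mat es (\<lambda>i j. f i j / (q i * q j)))"
    then have ij: "i < ?n" "j < ?n" by (simp_all add: enum_mat_def)
    have "(D * ?M * D) $$ (i, j) = (\<Sum>k\<in>{0..<?n}. (D * ?M) $$ (i, k) * D $$ (k, j))"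
      using ij carrier_matD[OF D] carrier_matD[OF enum_mat_carrier[of es f]]
      by (auto simp: scalar_prod_def intro!: sum.cong)
    also have "\<dots> = (\<Sum>k\<in>{0..<?n}. (if k = j then 1 / q (es ! j) else 0) * (f (es ! i) (es ! k) / q (es ! i)))"
    proof (rule sum.cong)
      fix k assume "k \<in> {0..<?n}"
      then have "D $$ (k, j) = (if k = j then 1 / q (es ! j) else 0)"
        "(D * ?M) $$ (i, k) = f (es ! i) (es ! k) / q (es ! i)"
        using ij DM[of i k] by (simp_all only: D_def) simp_all
      then show "(D * ?M) $$ (i, k) * D $$ (k, j) =
        (if k = j then 1 / q (es ! j) else 0) * (f (es ! i) (es ! k) / q (es ! i))"
        by (simp only: mult.commute)
    qed simp
    also have "\<dots> = 1 / q (es ! j) * (f (es ! i) (es ! j) / q (es ! i))"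
      by (rule sum_delta_times) (use ij in auto)
    finally show "(D * ?M * D) $$ (i, j) = enum_mat es (\<lambda>i j. f i j / (q i * q j)) $$ (i, j)"
      using ij by (simp add: enum_mat_def mult.commute)
  qed (use D car in \<open>auto simp: enum_mat_def\<close>)
  then have "Determinant.det (enum_mat es (\<lambda>i j. f i j / (q i * q j))) =
      Determinant.det D * Determinant.det ?M * Determinant.det D"
    using det_mult[OF car D] det_mult[OF D enum_mat_carrier] by simp
  moreover have "Determinant.det D = 1 / (\<Prod>e\<in>set es. q e)"
  proof -
    have "Determinant.det D = prod_list (diag_mat D)"
      by (rule det_upper_triangular[OF _ D]) (auto simp: D_def upper_triangular_def)
    also have "diag_mat D = map (\<lambda>e. 1 / q e) es"
      by (rule nth_equalityI) (auto simp: diag_mat_def D_def)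
    also have "prod_list \<dots> = (\<Prod>e\<in>set es. 1 / q e)"
      using prod.distinct_set_conv_list[OF assms] by metis
    finally show ?thesis by (simp add: prod_dividef)
  qed
  ultimately show ?thesis by (simp add: power2_eq_square)
qed

section \<open>Paths and cuts\<close>

lemma path_edges_Nil [simp]: "path_edges [] = {}"
  and path_edges_single [simp]: "path_edges [x] = {}"
  by (auto simp: path_edges_def)

lemma path_edges_Cons [simp]:
  "path_edges (x # y # ys) = insert {x, y} (path_edges (y # ys))" (is "?L = ?R")
proof
  show "?L \<subseteq> ?R"
  proof
    fix e assume "e \<in> ?L"
    then obtain i where i: "e = {(x # y # ys) ! i, (x # y # ys) ! Suc i}" "Suc i < length (x # y # ys)"
      by (auto simp: path_edges_def)
    show "e \<in> ?R"
    proof (cases i)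
      case 0
      then show ?thesis using i by simp
    next
      case (Suc m)
      then have "e = {(y # ys) ! m, (y # ys) ! Suc m}" "Suc m < length (y # ys)" using i by simp_all
      then have "e \<in> path_edges (y # ys)" unfolding path_edges_def by blast
      then show ?thesis by simp
    qed
  qed
  show "?R \<subseteq> ?L"
  proof
    fix e assume "e \<in> ?R"
    then consider "e = {x, y}" | i where "e = {(y # ys) ! i, (y # ys) ! Suc i}" "Suc i < length (y # ys)"
      by (auto simp: path_edges_def)
    then show "e \<in> ?L"
    proof cases
      case 1
      then show ?thesis unfolding path_edges_def by (auto intro!: exI[of _ 0])
    next
      case (2 i)
      then show ?thesis unfolding path_edges_def by (auto intro!: exI[of _ "Suc i"])
    qed
  qed
qed

lemma path_edges_subset_set: "e \<in> path_edges p \<Longrightarrow> e \<subseteq> set p"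
  by (auto simp: path_edges_def)

lemma path_edges_suffix: "path_edges zs \<subseteq> path_edges (ys @ zs)"
proof (induction ys)
  case (Cons y ys)
  then show ?case by (cases "ys @ zs") auto
qed simp

lemma reachable_path:
  assumes "(x, y) \<in> {(a, b). {a, b} \<in> edges G}\<^sup>*" and "y \<in> verts G" and "simple_graph G"
  shows "\<exists>p. path_between G x y p"
  using assms(1)
proof (induction rule: converse_rtrancl_induct)
  case base
  then show ?case using assms(2) by (intro exI[of _ "[y]"]) (simp add: path_between_def is_path_def)
next
  case (step x z)
  then obtain p where p: "path_between G z y p" by blast
  have e: "{x, z} \<in> edges G" using step by simp
  show ?case
  proof (cases "x \<in> set p")
    case True
    then obtain us ws where "p = us @ x # ws" by (meson split_list)
    then have "path_between G x y (x # ws)"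
      using p path_edges_suffix[of "x # ws" us] by (auto simp: path_between_def is_path_def)
    then show ?thesis by blast
  next
    case False
    have "x \<in> verts G" using e assms(3) by (fastforce simp: simple_graph_def doubleton_eq_iff)
    then have "path_between G x y (x # p)"
      using p False e by (cases p) (auto simp: path_between_def is_path_def)
    then show ?thesis by blast
  qed
qed

definition cut_edge :: "'a graph \<Rightarrow> 'a set \<Rightarrow> 'a set \<Rightarrow> bool" where
  "cut_edge G S e \<longleftrightarrow>
    (\<forall>x y. {x, y} \<in> edges G \<longrightarrow> (({x, y} = e) = ((x \<in> S) \<noteq> (y \<in> S))))"

text \<open>
  An edge that alone joins \<open>S\<close> to its complement is traversed at most once by a path, since the
  path repeats no vertex; all other steps stay on their side of \<open>S\<close>. Hence whether it is traversed
  depends on the two ends only.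
\<close>

lemma path_crosses_cut:
  assumes "p \<noteq> []" "distinct p" "path_edges p \<subseteq> edges G" "cut_edge G S e"
  shows "e \<in> path_edges p \<longleftrightarrow> (hd p \<in> S) \<noteq> (last p \<in> S)"
  using assms(1-3)
proof (induction p rule: induct_list012)
  case (3 x y ys)
  have xy: "({x, y} = e) = ((x \<in> S) \<noteq> (y \<in> S))"
    using 3 assms(4) by (simp add: cut_edge_def)
  have IH: "e \<in> path_edges (y # ys) \<longleftrightarrow> (y \<in> S) \<noteq> (last (y # ys) \<in> S)"
    using 3 by simp
  show ?case
  proof (cases "{x, y} = e")
    case True
    then have "e \<notin> path_edges (y # ys)"
      using path_edges_subset_set[of e "y # ys"] 3 by auto
    then show ?thesis using True xy IH by auto
  next
    case False
    then show ?thesis using xy IH by auto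
  qed
qed auto

text \<open>
  The pairs of elements of \<open>B\<close> that lie on different sides of \<open>X\<close> and also of \<open>Y\<close>; such
  elements are automatically distinct.
\<close>

definition separated_pairs :: "'b set \<Rightarrow> 'b set \<Rightarrow> 'b set \<Rightarrow> 'b set set" where
  "separated_pairs B X Y = {{x, y} | x y. x \<in> B \<and> y \<in> B \<and>
     (x \<in> X) \<noteq> (y \<in> X) \<and> (x \<in> Y) \<noteq> (y \<in> Y)}"

lemma pair_count_cut_edges:
  assumes "tree G" "cut_edge G S e" "cut_edge G T f"
  shows "pair_count G {e, f} = card (separated_pairs (boundary G) S T)"
proof -
  have "(\<exists>p. path_between G x y p \<and> {e, f} \<subseteq> path_edges p) \<longleftrightarrow>
      (x \<in> S) \<noteq> (y \<in> S) \<and> (x \<in> T) \<noteq> (y \<in> T)"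
    if "x \<in> boundary G" "y \<in> boundary G" for x y
  proof -
    have v: "x \<in> verts G" "y \<in> verts G" using that by (auto simp: boundary_def)
    note t = assms(1)[unfolded tree_def]
    have "(x, y) \<in> {(a, b). {a, b} \<in> edges G}\<^sup>*"
      using v by (rule t[THEN conjunct2, THEN conjunct2, THEN conjunct1, rule_format])
    from reachable_path[OF this v(2) t[THEN conjunct1]]
    obtain p where "path_between G x y p" by (elim exE)
    moreover have "{e, f} \<subseteq> path_edges p \<longleftrightarrow>
        (x \<in> S) \<noteq> (y \<in> S) \<and> (x \<in> T) \<noteq> (y \<in> T)" if "path_between G x y p" for p
      using path_crosses_cut[OF _ _ _ assms(2), of p] path_crosses_cut[OF _ _ _ assms(3), of p] that
      by (auto simp: path_between_def is_path_def)
    ultimately show ?thesis by blast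
  qed
  then have "{{x, y} | x y. x \<in> boundary G \<and> y \<in> boundary G \<and> x \<noteq> y \<and>
     (\<exists>p. path_between G x y p \<and> {e, f} \<subseteq> path_edges p)} = separated_pairs (boundary G) S T"
    unfolding separated_pairs_def by (intro Collect_cong ex_cong1) blast
  then show ?thesis by (simp only: pair_count_def)
qed

section \<open>Hierarchies of leaf sets\<close>

lemma separated_pairs_commute: "separated_pairs B X Y = separated_pairs B Y X"
  unfolding separated_pairs_def by (simp only: conj_ac)

lemma separated_pairs_Int: "separated_pairs B (X \<inter> B) (Y \<inter> B) = separated_pairs B X Y"
  unfolding separated_pairs_def by (intro Collect_cong ex_cong1) blast

lemma card_separated_pairs_product:
  assumes "finite X" "finite Y" "X \<inter> Y = {}" "S = {{x, y} | x y. x \<in> X \<and> y \<in> Y}"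
  shows "card S = card X * card Y"
proof -
  have "S = (\<lambda>(x, y). {x, y}) ` (X \<times> Y)" using assms(4) by auto
  moreover have "inj_on (\<lambda>(x, y). {x, y}) (X \<times> Y)"
    using assms(3) by (auto simp: inj_on_def doubleton_eq_iff)
  ultimately show ?thesis by (simp add: card_image card_cartesian_product)
qed

lemma card_separated_pairs_nested:
  assumes "finite B" "X \<subseteq> Y" "Y \<subseteq> B"
  shows "card (separated_pairs B X Y) = card X * card (B - Y)"
proof (rule card_separated_pairs_product)
  show "separated_pairs B X Y = {{x, y} | x y. x \<in> X \<and> y \<in> B - Y}" (is "?L = ?R")
  proof
    show "?L \<subseteq> ?R"
    proof
      fix e assume "e \<in> ?L"
      then obtain x y where e: "e = {x, y}" "x \<in> B" "y \<in> B"
        "(x \<in> X) \<noteq> (y \<in> X)" "(x \<in> Y) \<noteq> (y \<in> Y)" by (auto simp: separated_pairs_def)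
      then have "x \<in> X \<and> y \<in> B - Y \<or> y \<in> X \<and> x \<in> B - Y" using assms by blast
      then show "e \<in> ?R" using e(1) by blast
    qed
    show "?R \<subseteq> ?L" using assms unfolding separated_pairs_def by blast
  qed
qed (use assms in \<open>auto intro: finite_subset\<close>)

lemma card_separated_pairs_disjoint:
  assumes "finite B" "X \<inter> Y = {}" "X \<subseteq> B" "Y \<subseteq> B"
  shows "card (separated_pairs B X Y) = card X * card Y"
proof (rule card_separated_pairs_product)
  show "separated_pairs B X Y = {{x, y} | x y. x \<in> X \<and> y \<in> Y}" (is "?L = ?R")
  proof
    show "?L \<subseteq> ?R"
    proof
      fix e assume "e \<in> ?L"
      then obtain x y where e: "e = {x, y}" "x \<in> B" "y \<in> B"
        "(x \<in> X) \<noteq> (y \<in> X)" "(x \<in> Y) \<noteq> (y \<in> Y)" by (auto simp: separated_pairs_def)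
      then have "x \<in> X \<and> y \<in> Y \<or> y \<in> X \<and> x \<in> Y" using assms by blast
      then show "e \<in> ?R" using e(1) by blast
    qed
    show "?R \<subseteq> ?L" using assms unfolding separated_pairs_def by blast
  qed
qed (use assms in \<open>auto intro: finite_subset\<close>)

text \<open>
  This is a rooted binary tree seen through its edges alone. The tree hangs from one of its
  leaves, \<open>stem\<close> is the edge at that leaf, \<open>A e\<close> is the set of leaves below the edge \<open>e\<close>, and \<open>I\<close>
  contains the edges \<open>p\<close> whose lower end is an inner vertex, with the two edges \<open>l p\<close> and \<open>r p\<close>
  leaving that vertex downwards. The function \<open>rank\<close> is a post-order: an edge comes after all
  edges below it, and everything below \<open>l p\<close> comes before \<open>r p\<close>.
\<close>

locale leaf_hierarchy =
  fixes B :: "'b set" and E I :: "'e set" and stem :: 'e and l r :: "'e \<Rightarrow> 'e"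
    and A :: "'e \<Rightarrow> 'b set" and rank :: "'e \<Rightarrow> nat"
  assumes finite_B: "finite B" and finite_E: "finite E"
    and I_subset: "I \<subseteq> E" and stem_I: "stem \<in> I"
    and E_eq: "E = insert stem (l ` I \<union> r ` I)"
    and inj_l: "inj_on l I" and inj_r: "inj_on r I" and lr: "l ` I \<inter> r ` I = {}"
    and stem_notin: "stem \<notin> l ` I \<union> r ` I"
    and A_subset: "e \<in> E \<Longrightarrow> A e \<subseteq> B" and A_nonempty: "e \<in> E \<Longrightarrow> A e \<noteq> {}"
    and stem_leaf: "card (B - A stem) = 1"
    and leaf: "e \<in> E - I \<Longrightarrow> card (A e) = 1"
    and split: "p \<in> I \<Longrightarrow> A p = A (l p) \<union> A (r p)"
    and disj: "p \<in> I \<Longrightarrow> A (l p) \<inter> A (r p) = {}"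
    and laminar: "i \<in> E \<Longrightarrow> j \<in> E \<Longrightarrow> A i \<subseteq> A j \<or> A j \<subseteq> A i \<or> A i \<inter> A j = {}"
    and A_stem: "e \<in> E \<Longrightarrow> A e \<subseteq> A stem"
    and inj_rank: "inj_on rank E"
    and rank_mono: "i \<in> E \<Longrightarrow> j \<in> E \<Longrightarrow> A i \<subseteq> A j \<Longrightarrow> rank i \<le> rank j"
    and rank_lr: "p \<in> I \<Longrightarrow> rank (l p) < rank (r p)"
begin

abbreviation N :: real where "N \<equiv> real (card B)"
abbreviation a :: "'e \<Rightarrow> real" where "a e \<equiv> real (card (A e))"
abbreviation P :: "'e \<Rightarrow> 'e \<Rightarrow> real" where "P i j \<equiv> real (card (separated_pairs B (A i) (A j)))"

lemma children_in_E: "p \<in> I \<Longrightarrow> l p \<in> E" "p \<in> I \<Longrightarrow> r p \<in> E" "p \<in> I \<Longrightarrow> p \<in> E"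
  using E_eq I_subset by auto

lemma stem_E: "stem \<in> E"
  using I_subset stem_I by auto

lemma finite_A: "e \<in> E \<Longrightarrow> finite (A e)"
  using A_subset finite_B finite_subset by blast

lemma a_pos: "e \<in> E \<Longrightarrow> a e > 0"
  using A_nonempty finite_A by (simp add: card_gt_0_iff)

lemma a_complement: "e \<in> E \<Longrightarrow> real (card (B - A e)) = N - a e"
  using A_subset[of e] finite_B finite_A[of e]
  by (simp add: card_Diff_subset card_mono of_nat_diff)

lemma a_split: "p \<in> I \<Longrightarrow> a p = a (l p) + a (r p)"
  using split disj finite_A children_in_E by (simp add: card_Un_disjoint)

lemma a_stem: "a stem = N - 1"
  using a_complement[of stem] stem_leaf stem_E by simp

lemma N_pos: "N > 0"
  using a_stem a_pos[of stem] stem_E by simp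

lemma P_nested: "i \<in> E \<Longrightarrow> j \<in> E \<Longrightarrow> A i \<subseteq> A j \<Longrightarrow> P i j = a i * (N - a j)"
  using card_separated_pairs_nested[OF finite_B, of "A i" "A j"] A_subset a_complement by simp

lemma P_nested': "i \<in> E \<Longrightarrow> j \<in> E \<Longrightarrow> A j \<subseteq> A i \<Longrightarrow> P i j = a j * (N - a i)"
  using P_nested[of j i] by (simp add: separated_pairs_commute)

lemma P_disjoint: "i \<in> E \<Longrightarrow> j \<in> E \<Longrightarrow> A i \<inter> A j = {} \<Longrightarrow> P i j = a i * a j"
  using card_separated_pairs_disjoint[OF finite_B, of "A i" "A j"] A_subset by simp

text \<open>
  Seen from the vertex with the edges \<open>p\<close>, \<open>l p\<close>, \<open>r p\<close>, every edge lies in one of the three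
  branches; the branch above splits into the edges on the way to the root and the others.
\<close>

lemma position_cases:
  assumes "p \<in> I" "j \<in> E"
  obtains "A p \<subseteq> A j" | "A p \<inter> A j = {}" | "A j \<subseteq> A (l p)" | "A j \<subseteq> A (r p)"
  using laminar[OF assms(2) children_in_E(1)[OF assms(1)]] laminar[OF assms(2) children_in_E(2)[OF assms(1)]]
    laminar[OF assms(2) children_in_E(3)[OF assms(1)]] split[OF assms(1)] disj[OF assms(1)]
    A_nonempty[OF children_in_E(1)[OF assms(1)]] A_nonempty[OF children_in_E(2)[OF assms(1)]]
  by blast

text \<open>
  For an edge outside the two lower branches, the leaves below \<open>p\<close> contribute to \<open>P\<close> in proportion
  to their number, so that the row of \<open>r p\<close> is a multiple of the row of \<open>p\<close> there.
\<close>

lemma second_child_combination: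
  assumes p: "p \<in> I" and j: "j \<in> E" and "\<not> A j \<subseteq> A (l p)" "\<not> A j \<subseteq> A (r p)"
  shows "P (r p) j = a (r p) / a p * P p j"
  using p j
proof (cases rule: position_cases)
  case 1
  then have "A (r p) \<subseteq> A j" using split p by blast
  then show ?thesis using 1 P_nested[OF _ j] children_in_E p a_pos[of p] by simp
next
  case 2
  then have "A (r p) \<inter> A j = {}" using split p by blast
  then show ?thesis using 2 P_disjoint[OF _ j] children_in_E p a_pos[of p] by simp
qed (use assms in auto)

lemma second_child_pivot:
  assumes p: "p \<in> I"
  shows "P (r p) (r p) - a (r p) / a p * P p (r p) = N * a (l p) * a (r p) / a p"
proof -
  note E = children_in_E[OF p]
  have "A (r p) \<subseteq> A p" using split[OF p] by blast
  then have Peq: "P (r p) (r p) = a (r p) * (N - a (r p))" "P p (r p) = a (r p) * (N - a p)"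
    using P_nested[OF E(2) E(2)] P_nested'[OF E(3) E(2)] by simp_all
  have "a (l p) + a (r p) > 0" using a_pos[OF E(1)] a_pos[OF E(2)] by simp
  then show ?thesis unfolding Peq a_split[OF p] by (simp add: field_simps)
qed

text \<open>
  The combination has to vanish on the branch above \<open>p\<close> and on the branch of \<open>r p\<close>. On each of the
  two the rows involved are proportional, so these are two linear equations for the coefficients
  \<open>\<alpha>\<close> of the row of \<open>r p\<close> and \<open>\<beta>\<close> of the row of \<open>p\<close>,
  namely \<open>a (l p) = \<alpha> a (r p) + \<beta> a p\<close> and
  \<open>a (l p) = \<alpha> (N - a (r p)) + \<beta> (N - a p)\<close>, and the coefficients below are their solution.
\<close>

lemma first_child_combination:
  assumes p: "p \<in> I" and j: "j \<in> E" and nl: "\<not> A j \<subseteq> A (l p)"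
  shows "P (l p) j + (N - 2 * a p) / N * P (r p) j - (N - 2 * a (r p)) / N * P p j = 0"
proof -
  note E = children_in_E[OF p]
  note ap = a_split[OF p] and N = N_pos
  show ?thesis using p j
  proof (cases rule: position_cases)
    case 1
    then have "A (l p) \<subseteq> A j" "A (r p) \<subseteq> A j" using split p by blast+
    then have Peq: "P (l p) j = a (l p) * (N - a j)" "P (r p) j = a (r p) * (N - a j)"
      "P p j = a p * (N - a j)" using 1 P_nested[OF _ j] E by auto
    from N show ?thesis unfolding Peq ap by (simp add: field_simps)
  next
    case 2
    then have "A (l p) \<inter> A j = {}" "A (r p) \<inter> A j = {}" using split p by blast+
    then have Peq: "P (l p) j = a (l p) * a j" "P (r p) j = a (r p) * a j"
      "P p j = a p * a j" using 2 P_disjoint[OF _ j] E by auto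
    from N show ?thesis unfolding Peq ap by (simp add: field_simps)
  next
    case 4
    then have "A (l p) \<inter> A j = {}" "A j \<subseteq> A p" using split disj p by blast+
    then have Peq: "P (l p) j = a (l p) * a j" "P (r p) j = a j * (N - a (r p))"
      "P p j = a j * (N - a p)" using 4 P_disjoint[OF _ j] P_nested'[OF _ j] E by auto
    from N show ?thesis unfolding Peq ap by (simp add: field_simps)
  qed (use nl in auto)
qed

lemma first_child_pivot:
  assumes p: "p \<in> I"
  shows "P (l p) (l p) + (N - 2 * a p) / N * P (r p) (l p) - (N - 2 * a (r p)) / N * P p (l p)
    = 4 * a (l p) * a (r p) * (N - a p) / N"
proof -
  note E = children_in_E[OF p]
  have "A (l p) \<subseteq> A p" "A (r p) \<inter> A (l p) = {}" using split[OF p] disj[OF p] by blast+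
  then have Peq: "P (l p) (l p) = a (l p) * (N - a (l p))" "P (r p) (l p) = a (r p) * a (l p)"
    "P p (l p) = a (l p) * (N - a p)"
    using P_nested[OF E(1) E(1)] P_nested'[OF E(3) E(1)] P_disjoint[OF E(2) E(1)] by simp_all
  from N_pos show ?thesis
    unfolding Peq a_split[OF p] by (simp add: field_simps)
qed

lemma child_ranks:
  assumes p: "p \<in> I"
  shows "rank (l p) < rank (r p)" "rank (r p) < rank p"
proof -
  note E = children_in_E[OF p]
  have "\<not> A p \<subseteq> A (r p)"
    using disj[OF p] split[OF p] A_nonempty[OF E(1)] by blast
  then have "r p \<noteq> p" by (metis order_refl)
  then have "rank (r p) \<noteq> rank p" using inj_on_eq_iff[OF inj_rank E(2) E(3)] by blast
  then show "rank (r p) < rank p" using rank_mono[of "r p" p] E split[OF p] by auto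
qed (rule rank_lr[OF p])

lemma prod_over_E:
  fixes g :: "'e \<Rightarrow> real"
  shows "(\<Prod>e\<in>E - {stem}. g e) = (\<Prod>p\<in>I. g (l p) * g (r p))"
proof -
  have fI: "finite I" using I_subset finite_E finite_subset by blast
  have "E - {stem} = l ` I \<union> r ` I" using E_eq stem_notin by auto
  then show ?thesis
    using lr fI by (simp add: prod.union_disjoint prod.reindex inj_l inj_r prod.distrib)
qed

text \<open>
  Each vertex contributes the two pivots computed above, whose product is
  \<open>4 (a (l p))\<^sup>2 (a (r p))\<^sup>2 (N - a p) / a p\<close>. Regrouped by edges, the squares of the cluster sizes
  turn this into one factor \<open>4\<close> per vertex and one factor \<open>a p (N - a p)\<close> per edge that has an
  inner vertex at both ends.
\<close>

lemma det_separation_matrix: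
  assumes "distinct es" "set es = E"
  shows "Determinant.det (enum_mat es P) = 4 ^ card I * (\<Prod>p\<in>I - {stem}. a p * (N - a p))"
proof -
  define d where "d e = (if e = stem then a stem
     else if e \<in> l ` I then (let p = inv_into I l e in 4 * a (l p) * a (r p) * (N - a p) / N)
     else (let p = inv_into I r e in N * a (l p) * a (r p) / a p))" for e
  have d_stem: "d stem = a stem" by (simp add: d_def)
  have d_l: "d (l p) = 4 * a (l p) * a (r p) * (N - a p) / N" if "p \<in> I" for p
    using that stem_notin inj_l by (auto simp: d_def inv_into_f_f)
  have d_r: "d (r p) = N * a (l p) * a (r p) / a p" if "p \<in> I" for p
  proof -
    have "r p \<noteq> stem" "r p \<notin> l ` I" using that stem_notin lr by auto
    then show ?thesis using that inj_r by (simp add: d_def inv_into_f_f)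
  qed
  have fI: "finite I" using I_subset finite_E finite_subset by blast
  have "Determinant.det (enum_mat es P) = (\<Prod>e\<in>set es. d e)"
  proof (rule det_by_row_combinations[OF assms(1)])
    show "inj_on rank (set es)" using inj_rank assms(2) by simp
    fix e assume "e \<in> set es"
    then consider "e = stem" | p where "p \<in> I" "e = l p" | p where "p \<in> I" "e = r p"
      using assms(2) E_eq by blast
    then show "\<exists>c. c e = 1 \<and>
      (\<forall>i\<in>set es. rank i < rank e \<longrightarrow> c i = 0) \<and>
      (\<Sum>i\<in>set es. c i * P i e) = d e \<and>
      (\<forall>j\<in>set es. rank e < rank j \<longrightarrow> (\<Sum>i\<in>set es. c i * P i j) = 0)"
      unfolding assms(2)
    proof cases
      case 1
      define c :: "'e \<Rightarrow> real" where "c i = (if i = e then 1 else 0)" for i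
      have sum: "(\<Sum>i\<in>E. c i * P i j) = P e j" for j
        using finite_E 1 stem_E by (simp add: c_def sum_delta_times)
      have "rank j \<le> rank e" if "j \<in> E" for j using rank_mono[of j stem] A_stem that 1 stem_E by simp
      moreover have "P e e = d e" using P_nested[of stem stem] stem_E a_stem 1 d_stem by simp
      ultimately show "\<exists>c. c e = 1 \<and> (\<forall>i\<in>E. rank i < rank e \<longrightarrow> c i = 0) \<and>
        (\<Sum>i\<in>E. c i * P i e) = d e \<and> (\<forall>j\<in>E. rank e < rank j \<longrightarrow> (\<Sum>i\<in>E. c i * P i j) = 0)"
        unfolding sum[symmetric] by (intro exI[of _ c]) (force simp: c_def)
    next
      case (2 p)
      note E = children_in_E[OF 2(1)] and rk = child_ranks[OF 2(1)]
      define c where "c i = (if i = l p then 1 else 0) + (if i = r p then (N - 2 * a p) / N else 0)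
        + (if i = p then - ((N - 2 * a (r p)) / N) else 0)" for i
      have ne: "l p \<noteq> r p" "l p \<noteq> p" "r p \<noteq> p" using rk by auto
      have sum: "(\<Sum>i\<in>E. c i * P i j) =
          P (l p) j + (N - 2 * a p) / N * P (r p) j - (N - 2 * a (r p)) / N * P p j" for j
        using finite_E E
        by (simp add: c_def distrib_right sum.distrib sum_delta_times)
      have "c e = 1" using ne 2 by (simp add: c_def)
      moreover have "\<forall>i\<in>E. rank i < rank e \<longrightarrow> c i = 0" using rk 2 by (auto simp: c_def)
      moreover have "(\<Sum>i\<in>E. c i * P i e) = d e"
        unfolding sum using first_child_pivot[OF 2(1)] d_l 2 by simp
      moreover have "(\<Sum>i\<in>E. c i * P i j) = 0" if "j \<in> E" "rank e < rank j" for j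
      proof -
        have "\<not> A j \<subseteq> A (l p)" using rank_mono[OF that(1) E(1)] that(2) 2 by auto
        then show ?thesis unfolding sum by (rule first_child_combination[OF 2(1) that(1)])
      qed
      ultimately show "\<exists>c. c e = 1 \<and> (\<forall>i\<in>E. rank i < rank e \<longrightarrow> c i = 0) \<and>
        (\<Sum>i\<in>E. c i * P i e) = d e \<and> (\<forall>j\<in>E. rank e < rank j \<longrightarrow> (\<Sum>i\<in>E. c i * P i j) = 0)"
        by (intro exI[of _ c]) simp
    next
      case (3 p)
      note E = children_in_E[OF 3(1)] and rk = child_ranks[OF 3(1)]
      define c where "c i = (if i = r p then 1 else 0) + (if i = p then - (a (r p) / a p) else 0)" for i
      have sum: "(\<Sum>i\<in>E. c i * P i j) = P (r p) j - a (r p) / a p * P p j" for j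
        using finite_E E
        by (simp add: c_def distrib_right sum.distrib sum_delta_times)
      have "c e = 1" using rk 3 by (auto simp: c_def)
      moreover have "\<forall>i\<in>E. rank i < rank e \<longrightarrow> c i = 0" using rk 3 by (auto simp: c_def)
      moreover have "(\<Sum>i\<in>E. c i * P i e) = d e"
        unfolding sum using second_child_pivot[OF 3(1)] d_r 3 by simp
      moreover have "(\<Sum>i\<in>E. c i * P i j) = 0" if "j \<in> E" "rank e < rank j" for j
      proof -
        have "\<not> A j \<subseteq> A (l p)" using rank_mono[OF that(1) E(1)] that(2) 3 rk by auto
        moreover have "\<not> A j \<subseteq> A (r p)" using rank_mono[OF that(1) E(2)] that(2) 3 by auto
        ultimately show ?thesis unfolding sum using second_child_combination[OF 3(1) that(1)] by simp
      qed
      ultimately show "\<exists>c. c e = 1 \<and> (\<forall>i\<in>E. rank i < rank e \<longrightarrow> c i = 0) \<and>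
        (\<Sum>i\<in>E. c i * P i e) = d e \<and> (\<forall>j\<in>E. rank e < rank j \<longrightarrow> (\<Sum>i\<in>E. c i * P i j) = 0)"
        by (intro exI[of _ c]) simp
    qed
  qed
  also have "\<dots> = a stem * (\<Prod>e\<in>E - {stem}. d e)"
    using prod.remove[OF finite_E stem_E, of d] assms(2) d_stem by simp
  also have "(\<Prod>e\<in>E - {stem}. d e) =
      (\<Prod>p\<in>I. ((a (l p))\<^sup>2 * (a (r p))\<^sup>2) * (4 * ((N - a p) / a p)))"
    unfolding prod_over_E
    by (rule prod.cong) (use N_pos in \<open>simp_all add: d_l d_r power2_eq_square\<close>)
  also have "\<dots> = (\<Prod>e\<in>E - {stem}. (a e)\<^sup>2) * (4 ^ card I * (\<Prod>p\<in>I. (N - a p) / a p))"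
    unfolding prod_over_E by (simp only: prod.distrib prod_constant)
  also have "(\<Prod>e\<in>E - {stem}. (a e)\<^sup>2) = (\<Prod>p\<in>I - {stem}. (a p)\<^sup>2)"
  proof (rule prod.mono_neutral_right)
    have "a e = 1" if "e \<in> E - I" for e using leaf[OF that] by simp
    then show "\<forall>e\<in>E - {stem} - (I - {stem}). (a e)\<^sup>2 = 1" by fastforce
  qed (use finite_E I_subset in auto)
  also have "(\<Prod>p\<in>I. (N - a p) / a p) = 1 / a stem * (\<Prod>p\<in>I - {stem}. (N - a p) / a p)"
    using prod.remove[OF fI stem_I, of "\<lambda>p. (N - a p) / a p"] a_stem by simp
  also have "a stem * ((\<Prod>p\<in>I - {stem}. (a p)\<^sup>2) *
       (4 ^ card I * (1 / a stem * (\<Prod>p\<in>I - {stem}. (N - a p) / a p)))) =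
      4 ^ card I * (\<Prod>p\<in>I - {stem}. (a p)\<^sup>2 * ((N - a p) / a p))"
    unfolding prod.distrib using a_pos[OF stem_E] by simp
  also have "(\<Prod>p\<in>I - {stem}. (a p)\<^sup>2 * ((N - a p) / a p)) = (\<Prod>p\<in>I - {stem}. a p * (N - a p))"
    by (rule prod.cong) (use a_pos children_in_E in \<open>force simp: power2_eq_square\<close>)+
  finally show ?thesis .
qed

end

section \<open>The tree \<open>C n k\<close> as a hierarchy\<close>

text \<open>
  The tree is rooted at the leaf \<open>V (n - 2)\<close>, and an edge is represented by its lower end point.
\<close>

definition parent :: "nat \<Rightarrow> vertex \<Rightarrow> vertex" where
  "parent k v = (case v of V t \<Rightarrow> V (Suc t) | L t \<Rightarrow> V t | U \<Rightarrow> V k | W1 \<Rightarrow> U | W2 \<Rightarrow> U)"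

definition up_edge :: "nat \<Rightarrow> vertex \<Rightarrow> vertex set" where
  "up_edge k v = {v, parent k v}"

definition below :: "nat \<Rightarrow> vertex \<Rightarrow> vertex set" where
  "below k v = (case v of
      V t \<Rightarrow> V ` {..t} \<union> L ` {..t} \<union> (if k \<le> t then {U, W1, W2} else {})
    | U \<Rightarrow> {U, W1, W2} | _ \<Rightarrow> {v})"

definition leaves_below :: "nat \<Rightarrow> nat \<Rightarrow> vertex \<Rightarrow> vertex set" where
  "leaves_below n k v = below k v \<inter> boundary (C n k)"

definition nonroot :: "nat \<Rightarrow> nat \<Rightarrow> vertex set" where
  "nonroot n k = verts (C n k) - {V (n - 2)}"

definition inner :: "nat \<Rightarrow> vertex set" where
  "inner n = insert U (V ` {1..n - 3})"

definition left_child :: "vertex \<Rightarrow> vertex" where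
  "left_child v = (case v of V t \<Rightarrow> V (t - 1) | _ \<Rightarrow> W1)"

definition right_child :: "nat \<Rightarrow> vertex \<Rightarrow> vertex" where
  "right_child k v = (case v of V t \<Rightarrow> if t = k then U else L t | _ \<Rightarrow> W2)"

text \<open>
  Between \<open>V (t - 1)\<close> at \<open>5 t - 1\<close> and \<open>V t\<close> at \<open>5 t + 4\<close> there is room for what hangs off the
  spine at \<open>V t\<close>.
\<close>

definition postorder :: "nat \<Rightarrow> vertex \<Rightarrow> nat" where
  "postorder k v = (case v of
     V t \<Rightarrow> 5 * t + 4 | L t \<Rightarrow> 5 * t + 3 | U \<Rightarrow> 5 * k + 2 | W1 \<Rightarrow> 5 * k | W2 \<Rightarrow> 5 * k + 1)"

lemma nonroot_eq:
  assumes "2 \<le> k" "k \<le> n - 4"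
  shows "nonroot n k = V ` {..n - 3} \<union> L ` ({1..n - 3} - {k}) \<union> {U, W1, W2}"
proof -
  have "{0..n - 2} = insert (n - 2) {..n - 3}" using assms by auto
  then show ?thesis using assms by (auto simp: nonroot_def C_def)
qed

lemma boundary_C:
  assumes "2 \<le> k" "k \<le> n - 4"
  shows "boundary (C n k) = {V 0, V (n - 2), W1, W2} \<union> L ` ({1..n - 3} - {k})"
proof (rule Set.set_eqI)
  fix v :: vertex
  have "v \<in> boundary (C n k) \<longleftrightarrow>
      v \<in> verts (C n k) \<and> v \<in> {V 0, V (n - 2), W1, W2} \<union> range L"
    by (cases "v \<in> verts (C n k)") (simp_all add: boundary_def C_degree[OF assms])
  then show "v \<in> boundary (C n k) \<longleftrightarrow>
      v \<in> {V 0, V (n - 2), W1, W2} \<union> L ` ({1..n - 3} - {k})"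
    by (cases v) (auto simp: C_verts)
qed

lemma edges_C:
  assumes "2 \<le> k" "k \<le> n - 4"
  shows "edges (C n k) = up_edge k ` nonroot n k"
proof -
  have "{1..n - 2} = Suc ` {..n - 3}" using assms by (simp add: image_Suc_atMost)
  then have "{{V (t - 1), V t} | t. t \<in> {1..n - 2}} = (\<lambda>t. {V t, V (Suc t)}) ` {..n - 3}"
    by (auto simp: setcompr_eq_image image_image)
  moreover have "{{V t, L t} | t. t \<in> {1..n - 3} \<and> t \<noteq> k} = (\<lambda>t. {L t, V t}) ` ({1..n - 3} - {k})"
    by (auto simp: insert_commute)
  ultimately show ?thesis
    unfolding nonroot_eq[OF assms] C_def
    by (simp add: up_edge_def parent_def image_Un image_image insert_commute Un_assoc)
qed

lemma inj_up_edge: "inj_on (up_edge k) (nonroot n k)"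
proof -
  have "u = v" if "{u, parent k u} = {v, parent k v}" for u v
    using that by (cases u; cases v) (auto simp: parent_def doubleton_eq_iff)
  then show ?thesis by (auto simp: inj_on_def up_edge_def)
qed

lemma below_parent_iff:
  assumes "2 \<le> k" "k \<le> n - 4" "v \<in> nonroot n k" "w \<in> nonroot n k"
  shows "(w \<in> below k v) \<noteq> (parent k w \<in> below k v) \<longleftrightarrow> w = v"
  using assms(3,4) unfolding nonroot_eq[OF assms(1,2)]
  by (cases v; cases w) (auto simp: below_def parent_def)

lemma cut_edge_up_edge:
  assumes "2 \<le> k" "k \<le> n - 4" "v \<in> nonroot n k"
  shows "cut_edge (C n k) (below k v) (up_edge k v)"
  unfolding cut_edge_def
proof (intro allI impI)
  fix x y assume "{x, y} \<in> edges (C n k)"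
  then obtain w where w: "w \<in> nonroot n k" "{x, y} = up_edge k w"
    unfolding edges_C[OF assms(1,2)] by blast
  have "up_edge k w = up_edge k v \<longleftrightarrow> w = v"
    using inj_on_eq_iff[OF inj_up_edge w(1) assms(3)] .
  moreover have "x = w \<and> y = parent k w \<or> x = parent k w \<and> y = w"
    using w(2) unfolding up_edge_def by (auto simp: doubleton_eq_iff)
  ultimately show "({x, y} = up_edge k v) = ((x \<in> below k v) \<noteq> (y \<in> below k v))"
    using below_parent_iff[OF assms(1-3) w(1)] w(2) by auto
qed

lemma leaves_below_eq:
  assumes "2 \<le> k" "k \<le> n - 4"
  shows "t \<le> n - 3 \<Longrightarrow> leaves_below n k (V t) =
      {V 0} \<union> L ` ({1..t} - {k}) \<union> (if k \<le> t then {W1, W2} else {})"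
    and "t \<in> {1..n - 3} - {k} \<Longrightarrow> leaves_below n k (L t) = {L t}"
    and "leaves_below n k U = {W1, W2}"
    and "leaves_below n k W1 = {W1}" and "leaves_below n k W2 = {W2}"
  unfolding leaves_below_def boundary_C[OF assms] using assms by (auto simp: below_def)

lemma card_leaves_below_V:
  assumes "2 \<le> k" "k \<le> n - 4" "t \<le> n - 3"
  shows "card (leaves_below n k (V t)) = (if k \<le> t then t + 2 else t + 1)"
proof -
  have "card (L ` ({1..t} - {k})) = (if k \<le> t then t - 1 else t)"
    using assms by (subst card_image) (auto simp: inj_on_def card_Diff_singleton_if)
  moreover have "card (leaves_below n k (V t)) =
      1 + card (L ` ({1..t} - {k})) + (if k \<le> t then 2 else 0)"
    unfolding leaves_below_eq(1)[OF assms] by (subst card_Un_disjoint; (subst card_Un_disjoint)?) auto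
  ultimately show ?thesis using assms by auto
qed

lemma left_child_image:
  assumes "2 \<le> k" "k \<le> n - 4"
  shows "left_child ` inner n = insert W1 (V ` {..n - 4})"
proof -
  have "{1..n - 3} = Suc ` {..n - 4}" using assms by (simp add: image_Suc_atMost)
  then show ?thesis by (simp add: inner_def left_child_def image_image)
qed

lemma right_child_image:
  assumes "2 \<le> k" "k \<le> n - 4"
  shows "right_child k ` inner n = {U, W2} \<union> L ` ({1..n - 3} - {k})"
proof -
  have "{1..n - 3} = insert k ({1..n - 3} - {k})" using assms by auto
  then have "inner n = insert U (insert (V k) (V ` ({1..n - 3} - {k})))"
    unfolding inner_def by (metis image_insert)
  then show ?thesis by (auto simp: right_child_def image_iff)
qed

lemma C_leaf_hierarchy:
  assumes k: "2 \<le> k" "k \<le> n - 4"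
  shows "leaf_hierarchy (boundary (C n k)) (nonroot n k) (inner n) (V (n - 3))
    left_child (right_child k) (leaves_below n k) (postorder k)"
proof
  note nr = nonroot_eq[OF k] and lv = leaves_below_eq[OF k]
    and li = left_child_image[OF k] and ri = right_child_image[OF k]
  have inner_cases: "p = U \<or> p = V k \<or> (\<exists>t. p = V t \<and> t \<noteq> k \<and> 1 \<le> t \<and> t \<le> n - 3)" if "p \<in> inner n" for p
    using that by (auto simp: inner_def)
  show "finite (boundary (C n k))" by (simp add: boundary_C[OF k])
  show "finite (nonroot n k)" by (simp add: nr)
  show "inner n \<subseteq> nonroot n k" by (auto simp: inner_def nr)
  show "V (n - 3) \<in> inner n" using k by (auto simp: inner_def)
  show "nonroot n k = insert (V (n - 3)) (left_child ` inner n \<union> right_child k ` inner n)"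
  proof -
    have "{..n - 3} = insert (n - 3) {..n - 4}" using k by auto
    then show ?thesis unfolding li ri nr by auto
  qed
  show "inj_on left_child (inner n)" by (auto simp: inj_on_def inner_def left_child_def)
  show "inj_on (right_child k) (inner n)" by (auto simp: inj_on_def inner_def right_child_def)
  show "left_child ` inner n \<inter> right_child k ` inner n = {}" unfolding li ri by auto
  show "V (n - 3) \<notin> left_child ` inner n \<union> right_child k ` inner n"
    unfolding li ri using k by auto
  show "leaves_below n k e \<subseteq> boundary (C n k)" for e by (simp add: leaves_below_def)
  show "leaves_below n k e \<noteq> {}" if "e \<in> nonroot n k" for e
    using that unfolding nr by (elim UnE imageE insertE emptyE) (simp_all add: lv)
  show "card (boundary (C n k) - leaves_below n k (V (n - 3))) = 1"
  proof -
    have "boundary (C n k) - leaves_below n k (V (n - 3)) = {V (n - 2)}"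
      unfolding boundary_C[OF k] using k by (auto simp: lv)
    then show ?thesis by simp
  qed
  show leaf: "card (leaves_below n k e) = 1" if "e \<in> nonroot n k - inner n" for e
  proof -
    have "e = V 0 \<or> e \<in> {W1, W2} \<union> L ` ({1..n - 3} - {k})"
      using that unfolding nr inner_def by (auto simp: not_less_eq_eq)
    then show ?thesis using k by (elim disjE UnE imageE insertE emptyE) (simp_all add: lv)
  qed
  show "leaves_below n k p = leaves_below n k (left_child p) \<union> leaves_below n k (right_child k p)"
    if "p \<in> inner n" for p
    using inner_cases[OF that]
  proof (elim disjE exE conjE)
    fix t assume t: "p = V t" "t \<noteq> k" "1 \<le> t" "t \<le> n - 3"
    then have "{1..t} = insert t {1..t - 1}" "k \<le> t \<longleftrightarrow> k \<le> t - 1" by auto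
    then show ?thesis using t by (auto simp: left_child_def right_child_def lv)
  next
    assume "p = V k"
    moreover have "{1..k} - {k} = {1..k - 1} - {k}" by auto
    ultimately show ?thesis using k by (auto simp: left_child_def right_child_def lv)
  qed (auto simp: left_child_def right_child_def lv)
  show "leaves_below n k (left_child p) \<inter> leaves_below n k (right_child k p) = {}"
    if "p \<in> inner n" for p
    using inner_cases[OF that]
  proof (elim disjE exE conjE)
    fix t assume t: "p = V t" "t \<noteq> k" "1 \<le> t" "t \<le> n - 3"
    then show ?thesis by (auto simp: left_child_def right_child_def lv)
  next
    assume "p = V k"
    then show ?thesis using k by (auto simp: left_child_def right_child_def lv)
  qed (auto simp: left_child_def right_child_def lv)
  have V_mono: "leaves_below n k (V s) \<subseteq> leaves_below n k (V t)" if "s \<le> t" "t \<le> n - 3" for s t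
  proof -
    have "s \<le> n - 3" "L ` ({1..s} - {k}) \<subseteq> L ` ({1..t} - {k})" using that by auto
    then show ?thesis using that by (cases "k \<le> s"; cases "k \<le> t") (auto simp: lv)
  qed
  show "leaves_below n k e \<subseteq> leaves_below n k (V (n - 3))" if "e \<in> nonroot n k" for e
  proof (cases "\<exists>t. e = V t")
    case True
    then show ?thesis using that V_mono unfolding nr by auto
  next
    case False
    then show ?thesis using that k unfolding nr by (auto simp: lv)
  qed
  show "leaves_below n k i \<subseteq> leaves_below n k j \<or> leaves_below n k j \<subseteq> leaves_below n k i \<or>
      leaves_below n k i \<inter> leaves_below n k j = {}"
    if "i \<in> nonroot n k" "j \<in> nonroot n k" for i j
  proof -
    have single: "X \<subseteq> Y \<or> X \<inter> Y = {}" if "card X = 1" for X Y :: "vertex set"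
      using that by (auto simp: card_1_singleton_iff)
    consider "i \<notin> inner n" | "j \<notin> inner n" | "i = U" "j = U" | t where "i = U" "j = V t" "t \<le> n - 3"
      | s where "i = V s" "j = U" "s \<le> n - 3" | s t where "i = V s" "j = V t" "s \<le> n - 3" "t \<le> n - 3"
      unfolding inner_def by fastforce
    then show ?thesis
    proof cases
      case 1
      then show ?thesis using single[OF leaf[of i], of "leaves_below n k j"] that by blast
    next
      case 2
      then show ?thesis using single[OF leaf[of j], of "leaves_below n k i"] that by blast
    next
      case (4 t)
      then show ?thesis by (cases "k \<le> t") (auto simp: lv)
    next
      case (5 s)
      then show ?thesis by (cases "k \<le> s") (auto simp: lv)
    next
      case (6 s t)
      then show ?thesis using V_mono[of s t] V_mono[of t s] by (cases "s \<le> t") auto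
    qed simp
  qed
  show "inj_on (postorder k) (nonroot n k)"
  proof (rule inj_onI)
    fix u v assume "postorder k u = postorder k v"
    then show "u = v" by (cases u; cases v) (simp_all add: postorder_def, presburger+)
  qed
  show "postorder k i \<le> postorder k j"
    if i: "i \<in> nonroot n k" and j: "j \<in> nonroot n k" and sub: "leaves_below n k i \<subseteq> leaves_below n k j" for i j
  proof (cases "\<exists>s t. i = V s \<and> j = V t")
    case True
    then obtain s t where ij: "i = V s" "j = V t" by blast
    then have st: "i = V s" "j = V t" "s \<le> n - 3" "t \<le> n - 3" using i j unfolding nr by auto
    have "finite (leaves_below n k (V t))" using st by (simp add: lv)
    then have "card (leaves_below n k (V s)) \<le> card (leaves_below n k (V t))"
      using sub st by (simp add: card_mono)
    then have "s \<le> t" using card_leaves_below_V[OF k] st by (auto split: if_splits)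
    then show ?thesis using st by (simp add: postorder_def)
  next
    case False
    have mem: "x \<in> leaves_below n k j" if "x \<in> leaves_below n k i" for x using that sub by blast
    consider t where "j = V t" "t \<le> n - 3" | t where "j = L t" "t \<in> {1..n - 3} - {k}"
      | "j = U" | "j = W1" | "j = W2"
      using j unfolding nr by blast
    note j_cases = this
    show ?thesis
    proof (cases i)
      case (V s)
      then have "V 0 \<in> leaves_below n k j" using mem[of "V 0"] i unfolding nr by (auto simp: lv)
      moreover have "j \<noteq> V t" for t using False V by blast
      ultimately show ?thesis by (cases rule: j_cases) (auto simp: lv)
    next
      case (L s)
      then have "s \<in> {1..n - 3} - {k}" using i unfolding nr by auto
      then have "L s \<in> leaves_below n k j" using mem[of "L s"] L lv(2) by simp
      then show ?thesis using L by (cases rule: j_cases) (auto simp: lv postorder_def split: if_splits)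
    next
      case U
      then have "W1 \<in> leaves_below n k j" "W2 \<in> leaves_below n k j" using mem by (auto simp: lv)
      then show ?thesis using U by (cases rule: j_cases) (auto simp: lv postorder_def split: if_splits)
    next
      case W1
      then have "W1 \<in> leaves_below n k j" using mem by (auto simp: lv)
      then show ?thesis using W1 by (cases rule: j_cases) (auto simp: lv postorder_def split: if_splits)
    next
      case W2
      then have "W2 \<in> leaves_below n k j" using mem by (auto simp: lv)
      then show ?thesis using W2 by (cases rule: j_cases) (auto simp: lv postorder_def split: if_splits)
    qed
  qed
  show "postorder k (left_child p) < postorder k (right_child k p)" if "p \<in> inner n" for p
    using that k by (auto simp: inner_def postorder_def left_child_def right_child_def)
qed

section \<open>The determinant for \<open>C n k\<close>\<close>

lemma pair_count_up_edges:
  assumes "2 \<le> k" "k \<le> n - 4" "v \<in> nonroot n k" "w \<in> nonroot n k"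
  shows "pair_count (C n k) {up_edge k v, up_edge k w} =
    card (separated_pairs (boundary (C n k)) (leaves_below n k v) (leaves_below n k w))"
proof -
  have "tree (C n k)" using C_binary_tree[OF assms(1,2)] by (simp add: binary_tree_def)
  then show ?thesis
    unfolding leaves_below_def separated_pairs_Int
    by (rule pair_count_cut_edges) (rule cut_edge_up_edge[OF assms(1,2)], fact)+
qed

lemma Q_eq_enum_mat:
  assumes "2 \<le> k" "k \<le> n - 4" "edge_enumeration (C n k) es"
    and P: "P = (\<lambda>v w. real (card (separated_pairs (boundary (C n k)) (leaves_below n k v) (leaves_below n k w))))"
  obtains vs where "distinct vs" "set vs = nonroot n k"
    "Q (C n k) es = enum_mat vs (\<lambda>v w. P v w / (P v v * P w w))"
proof -
  define vs where "vs = map (inv_into (nonroot n k) (up_edge k)) es"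
  have es: "distinct es" "set es = up_edge k ` nonroot n k"
    using assms(3) edges_C[OF assms(1,2)] by (simp_all add: edge_enumeration_def)
  have "set vs = nonroot n k"
    unfolding vs_def set_map es(2) using inj_up_edge by (rule inv_into_image_cancel) simp
  moreover have "distinct vs"
    unfolding vs_def distinct_map using es inj_on_inv_into[of "set es" "up_edge k" "nonroot n k"] by simp
  moreover have nth: "es ! i = up_edge k (vs ! i)" "vs ! i \<in> nonroot n k" if "i < length es" for i
  proof -
    have "es ! i \<in> up_edge k ` nonroot n k" using that es(2) nth_mem by blast
    then show "es ! i = up_edge k (vs ! i)" "vs ! i \<in> nonroot n k"
      using that by (simp_all add: vs_def f_inv_into_f inv_into_into)
  qed
  have "Q (C n k) es = enum_mat vs (\<lambda>v w. P v w / (P v v * P w w))"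
  proof -
    have "length vs = length es" by (simp add: vs_def)
    moreover have "pair_count (C n k) {es ! i, es ! j} = P (vs ! i) (vs ! j)"
      if "i < length es" "j < length es" for i j
      using pair_count_up_edges[OF assms(1,2) nth(2)[OF that(1)] nth(2)[OF that(2)]] nth(1) that
      by (simp add: P)
    moreover from this[of i i for i] have "pair_count (C n k) {es ! i} = P (vs ! i) (vs ! i)"
      if "i < length es" for i using that by simp
    ultimately show ?thesis by (intro eq_matI) (simp_all add: Q_def enum_mat_def)
  qed
  ultimately show ?thesis using that by blast
qed

text \<open>
  The cluster sizes along the spine are the consecutive integers from \<open>2\<close> to \<open>n - 2\<close>, except that
  passing \<open>V k\<close> adds two leaves at once and leaves out \<open>k + 1\<close>. This gap is the only place where
  the determinant depends on \<open>k\<close>.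
\<close>

lemma prod_skip:
  fixes g :: "nat \<Rightarrow> real"
  assumes "2 \<le> k" "k \<le> n - 4"
  shows "(\<Prod>t\<in>{1..n - 4}. g (if k \<le> t then t + 2 else t + 1)) * g (k + 1) = (\<Prod>s\<in>{2..n - 2}. g s)"
proof -
  let ?h = "\<lambda>t. if k \<le> t then t + 2 else t + 1"
  have "s \<in> ?h ` {1..n - 4}" if "s \<in> {2..n - 2} - {k + 1}" for s
    using that assms by (intro image_eqI[of _ _ "if k + 2 \<le> s then s - 2 else s - 1"]) auto
  moreover have "?h t \<in> {2..n - 2} - {k + 1}" if "t \<in> {1..n - 4}" for t
    using that assms by auto
  ultimately have "?h ` {1..n - 4} = {2..n - 2} - {k + 1}"
    by (intro equalityI subsetI) (erule imageE, simp only:)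
  moreover have "inj_on ?h {1..n - 4}" by (auto simp: inj_on_def split: if_splits)
  ultimately have "(\<Prod>t\<in>{1..n - 4}. g (?h t)) = (\<Prod>s\<in>{2..n - 2} - {k + 1}. g s)"
    using prod.reindex[of ?h "{1..n - 4}" g] by (simp add: o_def)
  then show ?thesis using assms prod.remove[of "{2..n - 2}" "k + 1" g] by simp
qed

lemma prod_complementary:
  assumes "n \<ge> 4"
  shows "(\<Prod>s\<in>{2..n - 2}. real s * (real n - real s)) = (fact (n - 2))\<^sup>2"
proof -
  have f: "(\<Prod>s\<in>{2..n - 2}. real s) = fact (n - 2)"
  proof -
    have "{1..n - 2} = insert 1 {2..n - 2}" using assms by auto
    then show ?thesis by (simp add: fact_prod)
  qed
  have "(\<Prod>s\<in>{2..n - 2}. real n - real s) = (\<Prod>s\<in>{2..n - 2}. real s)"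
    using assms by (intro prod.reindex_bij_witness[of _ "\<lambda>s. n - s" "\<lambda>s. n - s"]) auto
  then show ?thesis by (simp add: prod.distrib f power2_eq_square)
qed

lemma det_Q_C:
  assumes k: "2 \<le> k" "k \<le> n - 4" and es: "edge_enumeration (C n k) es"
  shows "Determinant.det (Q (C n k) es) =
    4 ^ (n - 2) * (real k + 1) * (real n - real k - 1) /
      (2 * (real n - 1) ^ (2 * n) * (fact (n - 2))\<^sup>2 * (real n - 2))"
proof -
  interpret leaf_hierarchy "boundary (C n k)" "nonroot n k" "inner n" "V (n - 3)"
    left_child "right_child k" "leaves_below n k" "postorder k"
    by (rule C_leaf_hierarchy[OF k])
  have N: "N = real n" by (simp add: C_card_boundary[OF k])
  define q where "q v = a v * (real n - a v)" for v
  have Pq: "P v v = q v" if "v \<in> nonroot n k" for v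
    using P_nested[OF that that] N by (simp add: q_def)
  let ?interior = "inner n - {V (n - 3)}"
  obtain vs where vs: "distinct vs" "set vs = nonroot n k"
    "Q (C n k) es = enum_mat vs (\<lambda>v w. P v w / (P v v * P w w))"
    using Q_eq_enum_mat[OF k es refl] .
  have "Determinant.det (Q (C n k) es) = 4 ^ card (inner n) * (\<Prod>v\<in>?interior. q v) / (\<Prod>v\<in>nonroot n k. q v)\<^sup>2"
    unfolding vs(3) det_enum_mat_scaled[OF vs(1), of P "\<lambda>v. P v v"] det_separation_matrix[OF vs(1,2)]
    using Pq by (simp add: vs(2) q_def N cong: prod.cong)
  also have "(\<Prod>v\<in>nonroot n k. q v) = (real n - 1) ^ n * (\<Prod>v\<in>?interior. q v)"
  proof -
    \<comment> \<open>Apart from the interior edges there are exactly \<open>n\<close> edges, those at the leaves.\<close>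
    define X where "X = {V 0, V (n - 3), W1, W2} \<union> L ` ({1..n - 3} - {k})"
    have "{..n - 3} = {0, n - 3} \<union> ({1..n - 3} - {n - 3})" by auto
    then have split: "nonroot n k = X \<union> ?interior" "X \<inter> ?interior = {}"
      unfolding nonroot_eq[OF k] X_def inner_def by auto
    have "card X = 4 + card (L ` ({1..n - 3} - {k}))"
      unfolding X_def using k by (subst card_Un_disjoint) auto
    also have "\<dots> = n" using k by (subst card_image) (auto simp: inj_on_def)
    finally have X: "card X = n" .
    have "q v = real n - 1" if "v \<in> X" for v
    proof (cases "v = V (n - 3)")
      case True
      then show ?thesis using a_stem N by (simp add: q_def)
    next
      case False
      then have "v \<in> nonroot n k - inner n" using that split I_subset by blast
      then show ?thesis using leaf by (simp add: q_def)
    qed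
    then have "(\<Prod>v\<in>X. q v) = (real n - 1) ^ n" using X by simp
    moreover have "finite X" "finite ?interior" by (simp_all add: X_def inner_def)
    ultimately show ?thesis unfolding split(1) using prod.union_disjoint[OF _ _ split(2), of q] by simp
  qed
  also have "card (inner n) = n - 2"
  proof -
    have "card (V ` {1..n - 3}) = n - 3" by (subst card_image) (auto simp: inj_on_def)
    moreover have "U \<notin> V ` {1..n - 3}" by auto
    ultimately show ?thesis using k by (simp add: inner_def)
  qed
  also have "(\<Prod>v\<in>?interior. q v) = 2 * (real n - 2) * ((fact (n - 2))\<^sup>2 / ((real k + 1) * (real n - real k - 1)))"
  proof -
    have "{1..n - 3} = insert (n - 3) {1..n - 4}" "n - 3 \<notin> {1..n - 4}" using k by auto
    then have eq: "?interior = insert U (V ` {1..n - 4})" unfolding inner_def by auto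
    have "(\<Prod>v\<in>?interior. q v) = q U * (\<Prod>t\<in>{1..n - 4}. q (V t))"
      unfolding eq by (subst prod.insert) (auto simp: prod.reindex inj_on_def)
    also have "q U = 2 * (real n - 2)" using leaves_below_eq(3)[OF k] by (simp add: q_def)
    also have "(\<Prod>t\<in>{1..n - 4}. q (V t)) =
        (\<Prod>t\<in>{1..n - 4}. (\<lambda>s. real s * (real n - real s)) (if k \<le> t then t + 2 else t + 1))"
      using card_leaves_below_V[OF k] by (intro prod.cong) (auto simp: q_def)
    also have "\<dots> = (fact (n - 2))\<^sup>2 / ((real k + 1) * (real n - real k - 1))"
    proof -
      have "(\<Prod>t\<in>{1..n - 4}. (\<lambda>s. real s * (real n - real s)) (if k \<le> t then t + 2 else t + 1)) *
          ((real k + 1) * (real n - real k - 1)) = (fact (n - 2))\<^sup>2"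
        using prod_skip[OF k, of "\<lambda>s. real s * (real n - real s)"] prod_complementary[of n] k
        by (simp only: of_nat_add of_nat_1 diff_diff_eq)
      moreover have "(real k + 1) * (real n - real k - 1) \<noteq> 0" using k by auto
      from iffD2[OF nonzero_eq_divide_eq[OF this] calculation] show ?thesis .
    qed
    finally show ?thesis .
  qed
  also have "4 ^ (n - 2) * (2 * (real n - 2) * ((fact (n - 2))\<^sup>2 / ((real k + 1) * (real n - real k - 1)))) /
      ((real n - 1) ^ n * (2 * (real n - 2) * ((fact (n - 2))\<^sup>2 / ((real k + 1) * (real n - real k - 1)))))\<^sup>2 =
      4 ^ (n - 2) * (real k + 1) * (real n - real k - 1) /
      (2 * (real n - 1) ^ (2 * n) * (fact (n - 2))\<^sup>2 * (real n - 2))"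
  proof -
    define x f y z :: real where "x = 2 * (real n - 2)" "f = (fact (n - 2))\<^sup>2"
      "y = (real k + 1) * (real n - real k - 1)" "z = (real n - 1) ^ n"
    have "real n \<noteq> 2" "real n - real k - 1 \<noteq> 0" using k by auto
    then have nz: "x * (f / y) \<noteq> 0" by (simp add: x_f_y_z_def)
    have "c * g / (z * g)\<^sup>2 = c / (z\<^sup>2 * g)" if "g \<noteq> 0" for c g :: real
      using that by (simp add: power2_eq_square)
    from this[OF nz, of "4 ^ (n - 2)"]
    have "4 ^ (n - 2) * (x * (f / y)) / (z * (x * (f / y)))\<^sup>2 = 4 ^ (n - 2) * y / (2 * z\<^sup>2 * f * (x / 2))"
      by (simp add: mult.assoc mult.left_commute)
    then show ?thesis by (simp only: x_f_y_z_def power_mult[symmetric] mult.commute[of n 2] mult.assoc)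
  qed
  finally show ?thesis .
qed

lemma det_Q_C_ratio:
  assumes k: "2 \<le> k1" "k1 \<le> n - 4" "2 \<le> k2" "k2 \<le> n - 4"
    and es: "edge_enumeration (C n k1) es1" "edge_enumeration (C n k2) es2"
  shows "Determinant.det (Q (C n k1) es1) / Determinant.det (Q (C n k2) es2) =
    ((real k1 + 1) * (real n - real k1 - 1)) / ((real k2 + 1) * (real n - real k2 - 1))"
proof -
  have "c * x * y / d / (c * z * w / d) = x * y / (z * w)" if "c \<noteq> 0" "d \<noteq> 0" for c d x y z w :: real
    using that by simp
  then show ?thesis
    unfolding det_Q_C[OF k(1,2) es(1)] det_Q_C[OF k(3,4) es(2)] using k by (cases "n \<le> 2") simp_all
qed

theorem mainTheorem3:
  shows "(\<forall>n k es. 2 \<le> k \<and> k \<le> n - 4 \<and> edge_enumeration (C n k) es \<longrightarrow>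
            Determinant.det (Q (C n k) es) =
              4 ^ (n - 2) * (real k + 1) * (real n - real k - 1) /
              (2 * (real n - 1) ^ (2 * n) * (fact (n - 2))\<^sup>2 * (real n - 2)))
       \<and> (\<forall>n k1 k2 es1 es2.
            2 \<le> k1 \<and> k1 \<le> n - 4 \<and> edge_enumeration (C n k1) es1 \<and>
            2 \<le> k2 \<and> k2 \<le> n - 4 \<and> edge_enumeration (C n k2) es2 \<longrightarrow>
            Determinant.det (Q (C n k1) es1) / Determinant.det (Q (C n k2) es2) =
              ((real k1 + 1) * (real n - real k1 - 1)) /
              ((real k2 + 1) * (real n - real k2 - 1)))
       \<and> (\<forall>k1 k2 es1 es2.
            2 \<le> k1 \<and> 2 \<le> k2 \<and>
            (\<forall>n. k1 \<le> n - 4 \<and> k2 \<le> n - 4 \<longrightarrow>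
               edge_enumeration (C n k1) (es1 n) \<and> edge_enumeration (C n k2) (es2 n)) \<longrightarrow>
            convergent (\<lambda>n. Determinant.det (Q (C n k1) (es1 n)) / Determinant.det (Q (C n k2) (es2 n))))"
proof (intro conjI allI impI; elim conjE)
  show "Determinant.det (Q (C n k) es) =
      4 ^ (n - 2) * (real k + 1) * (real n - real k - 1) /
      (2 * (real n - 1) ^ (2 * n) * (fact (n - 2))\<^sup>2 * (real n - 2))"
    if "2 \<le> k" "k \<le> n - 4" "edge_enumeration (C n k) es" for n k es
    using that by (rule det_Q_C)
  show "Determinant.det (Q (C n k1) es1) / Determinant.det (Q (C n k2) es2) =
      ((real k1 + 1) * (real n - real k1 - 1)) / ((real k2 + 1) * (real n - real k2 - 1))"
    if "2 \<le> k1" "k1 \<le> n - 4" "edge_enumeration (C n k1) es1"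
      "2 \<le> k2" "k2 \<le> n - 4" "edge_enumeration (C n k2) es2" for n k1 k2 es1 es2
    using that by (intro det_Q_C_ratio)
  fix k1 k2 :: nat and es1 es2 :: "nat \<Rightarrow> vertex set list"
  assume k: "2 \<le> k1" "2 \<le> k2"
    and es: "\<forall>n. k1 \<le> n - 4 \<and> k2 \<le> n - 4 \<longrightarrow>
      edge_enumeration (C n k1) (es1 n) \<and> edge_enumeration (C n k2) (es2 n)"
  \<comment> \<open>Dividing numerator and denominator by \<open>n\<close> makes the limit visible.\<close>
  have "(\<lambda>n. (real k1 + 1) * (1 - (real k1 + 1) / real n) / ((real k2 + 1) * (1 - (real k2 + 1) / real n)))
      \<longlonglongrightarrow> (real k1 + 1) * (1 - 0) / ((real k2 + 1) * (1 - 0))"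
    by (intro tendsto_intros lim_const_over_n) simp
  moreover have "\<forall>\<^sub>F n in sequentially.
      (real k1 + 1) * (1 - (real k1 + 1) / real n) / ((real k2 + 1) * (1 - (real k2 + 1) / real n)) =
      Determinant.det (Q (C n k1) (es1 n)) / Determinant.det (Q (C n k2) (es2 n))"
    using eventually_ge_at_top[of "k1 + k2 + 4"]
  proof eventually_elim
    case (elim n)
    then have "k1 \<le> n - 4" "k2 \<le> n - 4" by auto
    then have "Determinant.det (Q (C n k1) (es1 n)) / Determinant.det (Q (C n k2) (es2 n)) =
        ((real k1 + 1) * (real n - real k1 - 1)) / ((real k2 + 1) * (real n - real k2 - 1))"
      using k es by (intro det_Q_C_ratio) auto
    moreover have "real n - real k - 1 = real n * (1 - (real k + 1) / real n)" for k
      using elim by (simp add: field_simps)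
    ultimately show ?case using elim by simp
  qed
  ultimately show "convergent (\<lambda>n. Determinant.det (Q (C n k1) (es1 n)) / Determinant.det (Q (C n k2) (es2 n)))"
    by (rule convergentI[OF Lim_transform_eventually])
qed

end
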